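(* Consider a one-site density $\Lambda^{1}$, i.e. a map $(a,b)\mapsto\Lambda^1_{a,b}$ assigning to each $a,b\in\mathbb{R}^+$, $a\ne b$, a probability density $\Lambda^1_{a,b}$ of a random variable taking values in $I_{a,b}$. The following two statements are equivalent: 1. There exists a symmetric and two-sided Markov family $\{\Lambda^n\}_{n\ge 1}$ with one-site density $\Lambda^1$. 2. For all $z_1,z_2\in\mathbb{R}^+$ there exists a symmetric function $g:\mathbb{R}^2\to\mathbb{R}^+$ such that for all $a,b\in I_{z_1,z_2}$, $a\neq b$, $$\Lambda^1_{a,b}(x)=f(a,b)\cdot g(b,x)\cdot g(x,a)\cdot \mathbf{1}(x\in I_{a,b})$$ with normalization $$f(a,b)=\Big(\int_{a\wedge b}^{a\vee b} g(b,y)\cdot g(y,a)\,dy\Big)^{-1}.$$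
   Context: Notation: $\mathbb{R}^+=(0,\infty)$; for $a,b\in\mathbb{R}^+$, $I_{a,b}=(a\wedge b,a\vee b)$ where $\wedge$ is minimum and $\vee$ is maximum. Pairs of parameters $(a,b)$ are always taken with $a\neq b$. The support of a function $f$ is $\mathrm{supp}(f)=\{x: f(x)\neq 0\}$. A function $g$ of two variables is symmetric if $g(u,v)=g(v,u)$ for all $u,v$. Families: a family $\{\Lambda^n\}_{n\ge1}$ assigns to every $n\ge 1$ and every $a,b\in\mathbb{R}^+$, $a\ne b$, a function $\Lambda^n_{a,b}:\mathbb{R}^n\to[0,\infty)$ which is a probability density (with respect to Lebesgue measure) of a random vector $(\Theta_1,\dots,\Theta_n)$ taking values in $(I_{a,b})^n$; it is taken to vanish outside $(I_{a,b})^n$. One sets $\Lambda^0_{a,b}:=1$. The $i$-th marginal is $$\Lambda^{n,i}_{a,b}(\theta_i)=\int_{-\infty}^\infty\cdots\int_{-\infty}^\infty \Lambda^n_{a,b}(\theta_1,\dots,\theta_n)\,d\theta_1\cdots d\theta_{i-1}\,d\theta_{i+1}\cdots d\theta_n,$$ and for $\theta_i\in\mathrm{supp}(\Lambda^{n,i}_{a,b})$ the conditional density is $\Lambda^n_{a,b}(\theta_1,\dots,\theta_n\mid\Theta_i=\theta_i):=\Lambda^n_{a,b}(\theta_1,\dots,\theta_n)/\Lambda^{n,i}_{a,b}(\theta_i)$. The family is two-sided Markov if for all $n\ge1$ and $a,b\in\mathbb{R}^+$: (i) $\Lambda^n_{a,b}(\theta_1,\dots,\theta_n\mid\Theta_j=\theta_j)=\Lambda^{j-1}_{a,\theta_j}(\theta_1,\dots,\theta_{j-1})\cdot\Lambda^{n-j}_{\theta_j,b}(\theta_{j+1},\dots,\theta_n)$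 for all $1\le j\le n$ and all $\theta_1,\dots,\theta_n\in I_{a,b}$ (whenever the conditional density is defined); and (ii) $\mathrm{supp}(\Lambda^1_{a,b})=I_{a,b}$. The family is symmetric if $\Lambda^n_{a,b}(\theta_1,\dots,\theta_n)=\Lambda^n_{b,a}(\theta_n,\dots,\theta_1)$ for all $n\ge1$, $a,b\in\mathbb{R}^+$ and $\theta_1,\dots,\theta_n\in I_{a,b}$.
   Formalization: Statement 2 additionally requires g to be Borel measurable and, for all n and a≠b in I_{z1,z2}, the integral of g(a,y1)g(y1,y2)...g(yn,b) over monotone chains between a and b to be finite; without these, 2 does not imply 1. *)

theory Defs
  imports "HOL-Analysis.Analysis"
begin

definition ival :: "real \<Rightarrow> real \<Rightarrow> real set" where
  "ival a b = {min a b <..< max a b}"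

text \<open>
  The space \<open>\<real>\<^sup>n\<close> with Lebesgue measure. A point \<open>(\<theta>\<^sub>1, \<dots>, \<theta>\<^sub>n)\<close> is a function that is
  \<open>undefined\<close> outside \<open>{1..n}\<close>; in particular \<open>\<real>\<^sup>0\<close> is a one-point space of mass 1.
\<close>

abbreviation leb :: "nat set \<Rightarrow> (nat \<Rightarrow> real) measure" where
  "leb J \<equiv> Pi\<^sub>M J (\<lambda>_. lborel)"

abbreviation cube :: "nat \<Rightarrow> real set \<Rightarrow> (nat \<Rightarrow> real) set" where
  "cube n A \<equiv> {1..n} \<rightarrow>\<^sub>E A"

definition pt1 :: "real \<Rightarrow> nat \<Rightarrow> real" where
  "pt1 x = (\<lambda>i\<in>{1..1}. x)"

definition prob_density_on :: "'a measure \<Rightarrow> 'a set \<Rightarrow> ('a \<Rightarrow> real) \<Rightarrow> bool" where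
  "prob_density_on M A p \<longleftrightarrow>
     p \<in> borel_measurable M \<and>
     (\<forall>x\<in>space M. 0 \<le> p x) \<and>
     (\<forall>x\<in>space M - A. p x = 0) \<and>
     (\<integral>\<^sup>+x. ennreal (p x) \<partial>M) = 1"

definition one_site_density :: "(real \<Rightarrow> real \<Rightarrow> real \<Rightarrow> real) \<Rightarrow> bool" where
  "one_site_density L \<longleftrightarrow>
     (\<forall>a>0. \<forall>b>0. a \<noteq> b \<longrightarrow> prob_density_on lborel (ival a b) (L a b))"

text \<open>A family is indexed by \<open>n \<ge> 1\<close>; the entry at \<open>0\<close> holds the convention \<open>\<Lambda>\<^sup>0 = 1\<close>.\<close>

type_synonym dens_family = "nat \<Rightarrow> real \<Rightarrow> real \<Rightarrow> (nat \<Rightarrow> real) \<Rightarrow> real"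

definition density_family :: "dens_family \<Rightarrow> bool" where
  "density_family \<Lambda> \<longleftrightarrow>
     (\<forall>a b \<theta>. \<Lambda> 0 a b \<theta> = 1) \<and>
     (\<forall>n\<ge>1. \<forall>a>0. \<forall>b>0. a \<noteq> b \<longrightarrow>
        prob_density_on (leb {1..n}) (cube n (ival a b)) (\<Lambda> n a b))"

definition has_one_site_density :: "dens_family \<Rightarrow> (real \<Rightarrow> real \<Rightarrow> real \<Rightarrow> real) \<Rightarrow> bool" where
  "has_one_site_density \<Lambda> L \<longleftrightarrow>
     (\<forall>a>0. \<forall>b>0. a \<noteq> b \<longrightarrow> (\<forall>x. \<Lambda> 1 a b (pt1 x) = L a b x))"

text \<open>
  Marginals and conditional densities take values in \<open>[0, \<infinity>]\<close>. With the Bochner integral, a point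
  where the marginal diverges would get the value 0 and hence wrongly drop out of the support.
\<close>

definition marginal :: "nat \<Rightarrow> nat \<Rightarrow> ((nat \<Rightarrow> real) \<Rightarrow> real) \<Rightarrow> real \<Rightarrow> ennreal" where
  "marginal n i p t = (\<integral>\<^sup>+\<omega>. ennreal (p (fun_upd \<omega> i t)) \<partial>leb ({1..n} - {i}))"

definition cond_density :: "nat \<Rightarrow> nat \<Rightarrow> ((nat \<Rightarrow> real) \<Rightarrow> real) \<Rightarrow> (nat \<Rightarrow> real) \<Rightarrow> ennreal" where
  "cond_density n j p \<theta> = ennreal (p \<theta>) / marginal n j p (\<theta> j)"

definition two_sided_markov :: "dens_family \<Rightarrow> bool" where
  "two_sided_markov \<Lambda> \<longleftrightarrow>
     (\<forall>n\<ge>1. \<forall>a>0. \<forall>b>0. a \<noteq> b \<longrightarrow>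
        (\<forall>j\<in>{1..n}. \<forall>\<theta>\<in>cube n (ival a b).
           marginal n j (\<Lambda> n a b) (\<theta> j) \<noteq> 0 \<longrightarrow>
           cond_density n j (\<Lambda> n a b) \<theta> =
             ennreal (\<Lambda> (j - 1) a (\<theta> j) (\<lambda>i\<in>{1..j - 1}. \<theta> i) *
                      \<Lambda> (n - j) (\<theta> j) b (\<lambda>i\<in>{1..n - j}. \<theta> (j + i)))) \<and>
        {x. \<Lambda> 1 a b (pt1 x) \<noteq> 0} = ival a b)"

definition symmetric_family :: "dens_family \<Rightarrow> bool" where
  "symmetric_family \<Lambda> \<longleftrightarrow>
     (\<forall>n\<ge>1. \<forall>a>0. \<forall>b>0. a \<noteq> b \<longrightarrow>
        (\<forall>\<theta>\<in>cube n (ival a b).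
           \<Lambda> n a b \<theta> = \<Lambda> n b a (\<lambda>i\<in>{1..n}. \<theta> (n + 1 - i))))"

definition normalization :: "(real \<Rightarrow> real \<Rightarrow> real) \<Rightarrow> real \<Rightarrow> real \<Rightarrow> real" where
  "normalization g a b = inverse (LINT y:ival a b|lborel. g b y * g y a)"

text \<open>
  For \<open>a < b\<close>, \<open>chain_mass g n a b\<close> is the integral of
  \<open>g(a,y\<^sub>1) g(y\<^sub>1,y\<^sub>2) \<dots> g(y\<^sub>n,b)\<close> over \<open>a < y\<^sub>1 < \<dots> < y\<^sub>n < b\<close> (similarly, decreasing, for
  \<open>a > b\<close>), i.e. the constant that normalizes the \<open>n\<close>-site density built from \<open>g\<close>.

  Its finiteness for \<open>n \<ge> 2\<close> does not follow from the case \<open>n = 1\<close>, and without it a one-site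
  density of the product form need not extend to a family. Take \<open>g(x,y) = g(y,x) = 1 + K(x - 1, y - 1)\<close>
  for \<open>x < y\<close> and \<open>g(x,x) = 1\<close>, with \<open>K(s,t) = s\<^sup>-\<^sup>2\<close> if \<open>0 < 2s < t < 3s\<close> and \<open>0\<close> otherwise. All
  integrals \<open>\<integral>g(b,y)g(y,a)dy\<close> over \<open>ival a b\<close> are finite. For \<open>a < 1 < b\<close> the two-sided Markov
  property forces \<open>\<Lambda>\<^sup>2(x,y) = C g(a,x) g(x,y) g(y,b)\<close> almost everywhere on \<open>a < x < y < b\<close>, with
  \<open>C > 0\<close>, and the integral of this diverges like \<open>\<integral>s \<cdot> s\<^sup>-\<^sup>2 ds\<close> at \<open>0\<close>.
\<close>

primrec chain_mass :: "(real \<Rightarrow> real \<Rightarrow> real) \<Rightarrow> nat \<Rightarrow> real \<Rightarrow> real \<Rightarrow> ennreal" where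
  "chain_mass g 0 a b = ennreal (g a b)"
| "chain_mass g (Suc n) a b =
     (\<integral>\<^sup>+y\<in>ival a b. chain_mass g n a y * ennreal (g y b) \<partial>lborel)"

end

theory Submission
  imports Defs
begin

text \<open>
  Everything rests on the weight \<open>g(a,x\<^sub>1) g(x\<^sub>1,x\<^sub>2) \<dots> g(x\<^sub>n,b)\<close> of a monotone chain from \<open>a\<close>
  to \<open>b\<close>, whose integral is \<open>chain_mass g n a b\<close>.

  From the product form to a family: the normalized chain weight is a density as soon as the chain
  mass is finite. Fixing one site splits a chain into two shorter ones, so the Markov property is
  immediate, and reversing a chain gives the symmetry. The difficulty is that \<open>g\<close> is given
  separately on each bounded interval, so \<open>\<Lambda>\<^sup>n\<^sub>a\<^sub>,\<^sub>b\<close> and the densities \<open>\<Lambda>\<^sup>j\<^sup>-\<^sup>1\<^sub>a\<^sub>,\<^sub>t\<close>, \<open>\<Lambda>\<^sup>n\<^sup>-\<^sup>j\<^sub>t\<^sub>,\<^sub>b\<close>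
  may come from different choices. They are nevertheless compatible, because the normalized chain
  weight depends on \<open>\<Lambda>\<^sup>1\<close> only (\<open>site_density_unique\<close>): for two choices, the ratio \<open>\<rho> = g / g'\<close>
  satisfies \<open>\<rho>(a,x) \<rho>(x,b) = const\<close> for \<open>x\<close> between \<open>a\<close> and \<open>b\<close>, and by induction the product of
  \<open>\<rho>\<close> along a chain from \<open>a\<close> to \<open>b\<close> depends on \<open>a\<close>, \<open>b\<close> and the number of sites only.

  From a family to the product form: only the joint density of the last two sites matters.
  Conditioning it on either site gives, for \<open>a < x < y < b\<close>,
  \<open>s\<^sub>n\<^sub>+\<^sub>1(x) \<Lambda>\<^sup>1\<^sub>x\<^sub>,\<^sub>b(y) = r\<^sub>n\<^sub>+\<^sub>1(y) r\<^sub>n\<^sub>;\<^sub>a\<^sub>,\<^sub>y(x)\<close>, where \<open>r\<close> and \<open>s\<close> are the densities of the last and the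
  last but one site (\<open>last_two_sites\<close>). Conditioning is available only where the marginals do not
  vanish, so one first has to see that they vanish nowhere (\<open>bivariate_marginals_positive\<close>). For two
  and three sites these identities express \<open>\<Lambda>\<^sup>1\<^sub>a\<^sub>,\<^sub>b(x)\<close> by densities on one fixed large interval, and
  this is the product form (\<open>kernel_factorizes\<close>). For more sites the same identity separates the
  variables \<open>x\<close> and \<open>y\<close>; hence \<open>r\<^sub>n\<close> is proportional to \<open>chain_mass g (n - 1) a y \<cdot> g(y,b)\<close>, and since
  it has integral 1, the chain mass is finite (\<open>chain_mass_finite\<close>).
\<close>

section \<open>Intervals and null sets\<close>

lemma mem_ival: "x \<in> ival a b \<longleftrightarrow> min a b < x \<and> x < max a b"
  by (simp add: ival_def)

lemma ival_less: "a < b \<Longrightarrow> x \<in> ival a b \<longleftrightarrow> a < x \<and> x < b"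
  by (simp add: mem_ival)

lemma ival_commute: "ival a b = ival b a"
  by (simp add: ival_def min.commute max.commute)

lemma sets_ival [measurable]: "ival a b \<in> sets borel"
  by (simp add: ival_def)

lemma AE_ival_imp_ex:
  assumes "a \<noteq> b" "AE x in lborel. x \<in> ival a b \<longrightarrow> P x"
  shows "\<exists>x\<in>ival a b. P x"
proof (rule ccontr)
  assume "\<not> ?thesis"
  with assms(2) have "AE x in lborel. x \<notin> ival a b"
    by (auto elim: AE_mp)
  then have "emeasure lborel (ival a b) = 0"
    by (simp add: AE_iff_measurable[OF _ refl])
  then show False using assms(1)
    by (auto simp: ival_def min_def max_def split: if_splits)
qed

lemma nn_integral_ival_pos:
  assumes "a \<noteq> b" "f \<in> borel_measurable borel" "\<And>y. y \<in> ival a b \<Longrightarrow> 0 < f y"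
  shows "0 < (\<integral>\<^sup>+y\<in>ival a b. f y \<partial>lborel)"
proof (rule ccontr)
  assume "\<not> ?thesis"
  then have "(\<integral>\<^sup>+y\<in>ival a b. f y \<partial>lborel) = 0" by simp
  moreover have "(\<lambda>y. f y * indicator (ival a b) y) \<in> borel_measurable lborel"
    using assms(2) by measurable
  ultimately have "AE y in lborel. f y * indicator (ival a b) y = 0"
    by (simp add: nn_integral_0_iff_AE)
  then have "AE y in lborel. y \<in> ival a b \<longrightarrow> f y = 0"
    by (rule AE_mp) (auto simp: indicator_def)
  from AE_ival_imp_ex[OF assms(1) this] assms(3) show False by force
qed

section \<open>Weights of monotone chains\<close>

interpretation lborel_seq: product_sigma_finite "\<lambda>_::nat. lborel :: real measure"
  by standard

text \<open>
  The density \<open>g(a,x\<^sub>1) g(x\<^sub>1,x\<^sub>2) \<dots> g(x\<^sub>n,b)\<close> of a chain, restricted to monotone chains. The sites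
  are the coordinates \<open>p + 1, \<dots>, p + n\<close>; the offset \<open>p\<close> lets the second half of a chain keep its
  coordinates when the chain is cut at a site. The indicator in the recursion step, applied
  repeatedly, forces \<open>x\<^sub>n\<close> between \<open>a\<close> and \<open>b\<close>, then \<open>x\<^sub>n\<^sub>-\<^sub>1\<close> between \<open>a\<close> and \<open>x\<^sub>n\<close>, and so on.
\<close>

primrec path_weight ::
  "(real \<Rightarrow> real \<Rightarrow> real) \<Rightarrow> nat \<Rightarrow> nat \<Rightarrow> real \<Rightarrow> real \<Rightarrow> (nat \<Rightarrow> real) \<Rightarrow> real" where
  "path_weight g p 0 a b \<theta> = g a b"
| "path_weight g p (Suc n) a b \<theta> =
     path_weight g p n a (\<theta> (p + Suc n)) \<theta> * g (\<theta> (p + Suc n)) b *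
     indicator (ival a b) (\<theta> (p + Suc n))"

lemma path_weight_nonneg: "(\<And>u v. 0 < g u v) \<Longrightarrow> 0 \<le> path_weight g p n a b \<theta>"
  by (induction n arbitrary: b) (auto intro!: mult_nonneg_nonneg intro: less_imp_le)

lemma path_weight_cong:
  assumes "\<And>i. 1 \<le> i \<Longrightarrow> i \<le> n \<Longrightarrow> \<theta> (p + i) = \<theta>' (q + i)"
  shows "path_weight g p n a b \<theta> = path_weight g q n a b \<theta>'"
  using assms
proof (induction n arbitrary: b)
  case (Suc n)
  have "\<theta> (p + Suc n) = \<theta>' (q + Suc n)" by (rule Suc.prems) auto
  then show ?case using Suc by simp
qed simp

lemma path_weight_eq_0:
  assumes "1 \<le> i" "i \<le> n" "\<theta> (p + i) \<notin> ival a b"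
  shows "path_weight g p n a b \<theta> = 0"
  using assms
proof (induction n arbitrary: b)
  case (Suc n)
  show ?case
  proof (cases "\<theta> (p + Suc n) \<in> ival a b \<and> i \<noteq> Suc n")
    case True
    then have "\<theta> (p + i) \<notin> ival a (\<theta> (p + Suc n))" "i \<le> n"
      using Suc.prems by (auto simp: mem_ival min_def max_def split: if_splits)
    then show ?thesis using Suc by simp
  next
    case False
    then show ?thesis using Suc.prems by (auto simp: indicator_def)
  qed
qed simp

text \<open>
  Cutting a chain at one site; this is the source of the Markov property. Each half contains its own
  monotonicity conditions, and together with the cut lying between \<open>a\<close> and \<open>b\<close> they say that the
  whole chain is monotone.
\<close>

lemma path_weight_split:
  "path_weight g p (j + Suc k) a b \<theta> =
     path_weight g p j a (\<theta> (p + Suc j)) \<theta> * path_weight g (p + Suc j) k (\<theta> (p + Suc j)) b \<theta> *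
     indicator (ival a b) (\<theta> (p + Suc j))"
proof (induction k arbitrary: b)
  case (Suc k)
  define t y where "t = \<theta> (p + Suc j)" and "y = \<theta> (p + Suc j + Suc k)"
  have "p + Suc (j + Suc k) = p + Suc j + Suc k" by simp
  then have "path_weight g p (j + Suc (Suc k)) a b \<theta> =
      path_weight g p (j + Suc k) a y \<theta> * g y b * indicator (ival a b) y"
    unfolding add_Suc_right path_weight.simps y_def by (simp only: add_Suc_right)
  moreover have "path_weight g (p + Suc j) (Suc k) t b \<theta> =
      path_weight g (p + Suc j) k t y \<theta> * g y b * indicator (ival t b) y"
    by (simp only: path_weight.simps y_def)
  moreover have "indicator (ival a y) t * indicator (ival a b) y =
        (indicator (ival a b) t * indicator (ival t b) y :: real)"
    by (auto simp: indicator_def mem_ival min_def max_def split: if_splits)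
  ultimately show ?case
    unfolding Suc.IH t_def[symmetric] by (simp add: algebra_simps)
qed simp

text \<open>
  The weight is defined by recursion at the right end; cutting off the first site instead gives the
  recursion at the left end, which is the former one for the reversed chain.
\<close>

lemma path_weight_rev:
  assumes "\<And>u v. g u v = g v u"
    and "\<And>i. 1 \<le> i \<Longrightarrow> i \<le> n \<Longrightarrow> \<theta> (p + i) = \<theta>' (q + (n + 1 - i))"
  shows "path_weight g p n a b \<theta> = path_weight g q n b a \<theta>'"
  using assms(2)
proof (induction n arbitrary: b q)
  case 0
  then show ?case using assms(1) by simp
next
  case (Suc n)
  define y where "y = \<theta> (p + Suc n)"
  have y: "\<theta>' (q + 1) = y" using Suc.prems[of "Suc n"] by (simp add: y_def)
  have "path_weight g p n a y \<theta> = path_weight g (q + 1) n y a \<theta>'"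
  proof (rule Suc.IH)
    fix i assume "1 \<le> i" "i \<le> n"
    then show "\<theta> (p + i) = \<theta>' (q + 1 + (n + 1 - i))"
      using Suc.prems[of i] by (simp add: Suc_diff_le)
  qed
  moreover have "path_weight g q (Suc n) b a \<theta>' =
      g b y * path_weight g (q + 1) n y a \<theta>' * indicator (ival b a) y"
    using path_weight_split[of g q 0 n b a \<theta>'] y by simp
  moreover have "path_weight g p (Suc n) a b \<theta> =
      path_weight g p n a y \<theta> * g y b * indicator (ival a b) y"
    by (simp only: path_weight.simps y_def)
  ultimately show ?case
    using assms(1)[of y b] ival_commute[of a b] by simp
qed

lemma measurable_weight:
  fixes g :: "real \<Rightarrow> real \<Rightarrow> real"
  assumes "case_prod g \<in> borel_measurable borel" "u \<in> borel_measurable M" "v \<in> borel_measurable M"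
  shows "(\<lambda>x. g (u x) (v x)) \<in> borel_measurable M"
  using measurable_compose[OF borel_measurable_Pair[OF assms(2,3)] assms(1)] by simp

lemma measurable_indicator_ival:
  fixes u v y :: "'b \<Rightarrow> real"
  assumes [measurable]: "u \<in> borel_measurable M" "v \<in> borel_measurable M" "y \<in> borel_measurable M"
  shows "(\<lambda>x. indicator (ival (u x) (v x)) (y x) :: real) \<in> borel_measurable M"
    and "(\<lambda>x. indicator (ival (u x) (v x)) (y x) :: ennreal) \<in> borel_measurable M"
  unfolding indicator_def mem_ival by measurable

lemma measurable_path_weight:
  assumes "case_prod g \<in> borel_measurable borel"
    and "u \<in> borel_measurable M" "v \<in> borel_measurable M"
    and "\<And>i. 1 \<le> i \<Longrightarrow> i \<le> n \<Longrightarrow> (\<lambda>x. \<theta> x (p + i)) \<in> borel_measurable M"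
  shows "(\<lambda>x. path_weight g p n (u x) (v x) (\<theta> x)) \<in> borel_measurable M"
  using assms(3,4)
proof (induction n arbitrary: v)
  case 0
  then show ?case using measurable_weight[OF assms(1,2)] by simp
next
  case (Suc n)
  have y: "(\<lambda>x. \<theta> x (p + Suc n)) \<in> borel_measurable M"
    by (rule Suc.prems) auto
  have "(\<lambda>x. path_weight g p n (u x) (\<theta> x (p + Suc n)) (\<theta> x)) \<in> borel_measurable M"
    using Suc.prems by (intro Suc.IH y) auto
  then show ?case
    unfolding path_weight.simps
    by (intro borel_measurable_times measurable_weight[OF assms(1)]
        measurable_indicator_ival assms(2) y Suc.prems)
qed

lemma measurable_chain_mass:
  assumes g: "case_prod g \<in> borel_measurable borel"
    and u: "u \<in> borel_measurable M" and v: "v \<in> borel_measurable M"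
  shows "(\<lambda>x. chain_mass g n (u x) (v x)) \<in> borel_measurable M"
proof -
  have "(\<lambda>z. chain_mass g n (fst z) (snd z)) \<in> borel_measurable (borel \<Otimes>\<^sub>M borel)"
  proof (induction n)
    case 0
    show ?case unfolding chain_mass.simps
      by (intro measurable_compose[OF _ measurable_ennreal] measurable_weight[OF g]) measurable
  next
    case (Suc n)
    let ?M = "(borel \<Otimes>\<^sub>M borel) \<Otimes>\<^sub>M borel :: ((real \<times> real) \<times> real) measure"
    have s: "(\<lambda>z. fst (fst z)) \<in> borel_measurable ?M"
      and t: "(\<lambda>z. snd (fst z)) \<in> borel_measurable ?M"
      and y: "snd \<in> borel_measurable ?M"
      by measurable
    have c: "(\<lambda>z. chain_mass g n (fst (fst z)) (snd z)) \<in> borel_measurable ?M"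
      using measurable_compose[OF measurable_Pair[OF s y] Suc] by simp
    have "(\<lambda>z. chain_mass g n (fst (fst z)) (snd z) * ennreal (g (snd z) (snd (fst z))) *
          indicator (ival (fst (fst z)) (snd (fst z))) (snd z)) \<in> borel_measurable ?M"
      by (intro borel_measurable_times_ennreal measurable_indicator_ival
          measurable_compose[OF _ measurable_ennreal] measurable_weight[OF g] s t y c)
    then show ?case
      unfolding chain_mass.simps
      by (intro lborel.borel_measurable_nn_integral) (simp add: split_beta')
  qed
  from measurable_compose[OF measurable_Pair[OF u v] this] show ?thesis by simp
qed

section \<open>Integrals of chain weights\<close>

lemma nn_integral_path_weight:
  assumes g: "case_prod g \<in> borel_measurable borel" "\<And>u v. 0 < g u v"
  shows "(\<integral>\<^sup>+\<theta>. ennreal (path_weight g p n a b \<theta>) \<partial>leb {p+1..p+n}) = chain_mass g n a b"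
proof (induction n arbitrary: b)
  case 0
  show ?case by (simp add: PiM_empty)
next
  case (Suc n)
  have set_eq: "{p+1..p+Suc n} = insert (p + Suc n) {p+1..p+n}" by auto
  have meas: "(\<lambda>\<theta>. ennreal (path_weight g p (Suc n) a b \<theta>)) \<in>
      borel_measurable (leb {p+1..p+Suc n})"
    by (intro measurable_compose[OF _ measurable_ennreal] measurable_path_weight[OF g(1)]) measurable
  have "(\<integral>\<^sup>+\<theta>. ennreal (path_weight g p (Suc n) a b \<theta>) \<partial>leb {p+1..p+Suc n}) =
     (\<integral>\<^sup>+y. (\<integral>\<^sup>+\<theta>. ennreal (path_weight g p (Suc n) a b (\<theta>(p + Suc n := y)))
        \<partial>leb {p+1..p+n}) \<partial>lborel)"
    unfolding set_eq by (rule lborel_seq.product_nn_integral_insert_rev) (use meas[unfolded set_eq] in auto)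
  also have "\<dots> = (\<integral>\<^sup>+y. (\<integral>\<^sup>+\<theta>. ennreal (path_weight g p n a y \<theta>) *
      (ennreal (g y b) * indicator (ival a b) y) \<partial>leb {p+1..p+n}) \<partial>lborel)"
  proof (intro nn_integral_cong)
    fix y :: real and \<theta> :: "nat \<Rightarrow> real"
    have "path_weight g p (Suc n) a b (\<theta>(p + Suc n := y)) =
        path_weight g p n a y \<theta> * (g y b * indicator (ival a b) y)"
      using path_weight_cong[of n "\<theta>(p + Suc n := y)" p \<theta> p g a y] by simp
    also have "ennreal \<dots> = ennreal (path_weight g p n a y \<theta>) *
        (ennreal (g y b) * indicator (ival a b) y)"
      using g(2)[of y b] path_weight_nonneg[OF g(2)]
      by (simp add: ennreal_mult indicator_def)
    finally show "ennreal (path_weight g p (Suc n) a b (\<theta>(p + Suc n := y))) = \<dots>" .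
  qed
  also have "\<dots> = chain_mass g (Suc n) a b"
    unfolding chain_mass.simps
  proof (intro nn_integral_cong)
    fix y
    have "(\<lambda>\<theta>. ennreal (path_weight g p n a y \<theta>)) \<in> borel_measurable (leb {p+1..p+n})"
      by (intro measurable_compose[OF _ measurable_ennreal] measurable_path_weight[OF g(1)]) measurable
    then show "(\<integral>\<^sup>+\<theta>. ennreal (path_weight g p n a y \<theta>) *
      (ennreal (g y b) * indicator (ival a b) y) \<partial>leb {p+1..p+n}) =
      chain_mass g n a y * ennreal (g y b) * indicator (ival a b) y"
      using Suc.IH[of y] by (simp add: nn_integral_multc mult.assoc)
  qed
  finally show ?case .
qed

text \<open>
  The unnormalized marginal of one site. After the cut at that site, the two halves depend on
  disjoint sets of coordinates, so that their integrals separate.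
\<close>

lemma nn_integral_path_weight_fixed_site:
  assumes g: "case_prod g \<in> borel_measurable borel" "\<And>u v. 0 < g u v"
  shows "(\<integral>\<^sup>+\<theta>. ennreal (path_weight g 0 (j + Suc k) a b (\<theta>(Suc j := t)))
            \<partial>leb ({1..j + Suc k} - {Suc j})) =
         chain_mass g j a t * chain_mass g k t b * indicator (ival a b) t"
proof -
  define I J where "I = {0+1..0+j}" and "J = {Suc j+1..Suc j+k}"
  have IJ: "I \<inter> J = {}" "finite I" "finite J" "{1..j + Suc k} - {Suc j} = I \<union> J"
    by (auto simp: I_def J_def)
  have "(\<integral>\<^sup>+\<theta>. ennreal (path_weight g 0 (j + Suc k) a b (\<theta>(Suc j := t))) \<partial>leb (I \<union> J)) =
    (\<integral>\<^sup>+x. \<integral>\<^sup>+y. ennreal (path_weight g 0 (j + Suc k) a b ((merge I J (x, y))(Suc j := t)))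
      \<partial>leb J \<partial>leb I)"
  proof (rule lborel_seq.product_nn_integral_fold[OF IJ(1-3)])
    have "(\<lambda>\<theta>. (\<theta>(Suc j := t)) (0 + i)) \<in> borel_measurable (leb (I \<union> J))"
      if "1 \<le> i" "i \<le> j + Suc k" for i
    proof (cases "i = Suc j")
      case False
      then have "i \<in> I \<union> J" using that by (auto simp: I_def J_def)
      then show ?thesis using False by simp
    qed simp
    then show "(\<lambda>\<theta>. ennreal (path_weight g 0 (j + Suc k) a b (\<theta>(Suc j := t)))) \<in>
        borel_measurable (leb (I \<union> J))"
      by (intro measurable_compose[OF _ measurable_ennreal] measurable_path_weight[OF g(1)]) auto
  qed
  also have "\<dots> = (\<integral>\<^sup>+x. \<integral>\<^sup>+y. (ennreal (path_weight g 0 j a t x) * indicator (ival a b) t) *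
      ennreal (path_weight g (Suc j) k t b y) \<partial>leb J \<partial>leb I)"
  proof (intro nn_integral_cong)
    fix x y :: "nat \<Rightarrow> real"
    let ?\<theta> = "(merge I J (x, y))(Suc j := t)"
    have "path_weight g 0 j a t ?\<theta> = path_weight g 0 j a t x"
      by (rule path_weight_cong) (auto simp: merge_def I_def)
    moreover have "path_weight g (Suc j) k t b ?\<theta> = path_weight g (Suc j) k t b y"
      by (rule path_weight_cong) (auto simp: merge_def I_def J_def)
    ultimately have "path_weight g 0 (j + Suc k) a b ?\<theta> =
       path_weight g 0 j a t x * path_weight g (Suc j) k t b y * indicator (ival a b) t"
      unfolding path_weight_split by simp
    then show "ennreal (path_weight g 0 (j + Suc k) a b ?\<theta>) =
      (ennreal (path_weight g 0 j a t x) * indicator (ival a b) t) *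
        ennreal (path_weight g (Suc j) k t b y)"
      using path_weight_nonneg[OF g(2)] by (simp add: ennreal_mult indicator_def)
  qed
  also have "\<dots> = (\<integral>\<^sup>+x. ennreal (path_weight g 0 j a t x) *
      (indicator (ival a b) t * chain_mass g k t b) \<partial>leb I)"
  proof (intro nn_integral_cong)
    fix x
    have "(\<lambda>y. ennreal (path_weight g (Suc j) k t b y)) \<in> borel_measurable (leb J)"
      unfolding J_def
      by (intro measurable_compose[OF _ measurable_ennreal] measurable_path_weight[OF g(1)]) measurable
    then show "(\<integral>\<^sup>+y. (ennreal (path_weight g 0 j a t x) * indicator (ival a b) t) *
      ennreal (path_weight g (Suc j) k t b y) \<partial>leb J) = ennreal (path_weight g 0 j a t x) *
      (indicator (ival a b) t * chain_mass g k t b)"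
      using nn_integral_path_weight[OF g, of "Suc j" k t b]
      by (simp add: nn_integral_cmult J_def mult.assoc)
  qed
  also have "\<dots> = chain_mass g j a t * (indicator (ival a b) t * chain_mass g k t b)"
  proof -
    have "(\<lambda>y. ennreal (path_weight g 0 j a t y)) \<in> borel_measurable (leb I)"
      unfolding I_def
      by (intro measurable_compose[OF _ measurable_ennreal] measurable_path_weight[OF g(1)]) measurable
    then show ?thesis
      using nn_integral_path_weight[OF g, of 0 j a t] by (simp add: nn_integral_multc I_def)
  qed
  finally show ?thesis unfolding IJ(4) by (simp add: mult_ac)
qed

text \<open>
  The mirror image of the defining recursion: both come from integrating the chain weight, with the
  first or the last site integrated outermost.
\<close>

lemma chain_mass_Suc_left:
  assumes g: "case_prod g \<in> borel_measurable borel" "\<And>u v. 0 < g u v"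
  shows "chain_mass g (Suc n) a b =
     (\<integral>\<^sup>+t\<in>ival a b. ennreal (g a t) * chain_mass g n t b \<partial>lborel)"
proof -
  have set_eq: "{0+1..0+Suc n} = insert 1 ({1..0 + Suc n} - {Suc 0})" by auto
  have "chain_mass g (Suc n) a b = (\<integral>\<^sup>+\<theta>. ennreal (path_weight g 0 (Suc n) a b \<theta>) \<partial>leb {0+1..0+Suc n})"
    by (rule nn_integral_path_weight[OF g, symmetric])
  also have "\<dots> = (\<integral>\<^sup>+t. (\<integral>\<^sup>+\<theta>. ennreal (path_weight g 0 (Suc n) a b (\<theta>(1 := t)))
      \<partial>leb ({1..0 + Suc n} - {Suc 0})) \<partial>lborel)"
    unfolding set_eq
  proof (rule lborel_seq.product_nn_integral_insert_rev)
    show "(\<lambda>\<theta>. ennreal (path_weight g 0 (Suc n) a b \<theta>)) \<in>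
        borel_measurable (leb (insert 1 ({1..0 + Suc n} - {Suc 0})))"
      by (intro measurable_compose[OF _ measurable_ennreal] measurable_path_weight[OF g(1)]) measurable
  qed auto
  also have "\<dots> = (\<integral>\<^sup>+t\<in>ival a b. ennreal (g a t) * chain_mass g n t b \<partial>lborel)"
    using nn_integral_path_weight_fixed_site[OF g, of 0 n a b]
    by (intro nn_integral_cong) simp
  finally show ?thesis .
qed

lemma chain_mass_commute:
  assumes g: "case_prod g \<in> borel_measurable borel" "\<And>u v. 0 < g u v" "\<And>u v. g u v = g v u"
  shows "chain_mass g n a b = chain_mass g n b a"
proof (induction n arbitrary: a b)
  case 0
  show ?case using g(3) by simp
next
  case (Suc n)
  show ?case
    unfolding chain_mass_Suc_left[OF g(1,2), of n b a]
    by (simp add: ival_commute[of b a] Suc[of a] g(3)[of b] mult.commute)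
qed

lemma chain_mass_pos:
  assumes g: "case_prod g \<in> borel_measurable borel" "\<And>u v. 0 < g u v" and "a \<noteq> b"
  shows "0 < chain_mass g n a b"
  using assms(3)
proof (induction n arbitrary: b)
  case 0
  show ?case using g(2) by simp
next
  case (Suc n)
  show ?case
    unfolding chain_mass.simps
  proof (rule nn_integral_ival_pos[OF Suc.prems])
    show "(\<lambda>y. chain_mass g n a y * ennreal (g y b)) \<in> borel_measurable borel"
      by (intro borel_measurable_times_ennreal measurable_chain_mass[OF g(1)]
          measurable_compose[OF _ measurable_ennreal] measurable_weight[OF g(1)]) auto
  next
    fix y assume "y \<in> ival a b"
    then have "a \<noteq> y" by (auto simp: mem_ival)
    then show "0 < chain_mass g n a y * ennreal (g y b)"
      using Suc.IH g(2) by (simp add: ennreal_zero_less_mult_iff)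
  qed
qed

section \<open>Factorizations of a one-site density\<close>

definition factorization_on ::
  "(real \<Rightarrow> real \<Rightarrow> real \<Rightarrow> real) \<Rightarrow> real set \<Rightarrow> (real \<Rightarrow> real \<Rightarrow> real) \<Rightarrow> bool" where
  "factorization_on L J g \<longleftrightarrow>
     (\<forall>u v. g u v > 0) \<and>
     (\<forall>u v. g u v = g v u) \<and>
     case_prod g \<in> borel_measurable borel \<and>
     (\<forall>a\<in>J. \<forall>b\<in>J. a \<noteq> b \<longrightarrow>
        (\<forall>x. L a b x = normalization g a b * g b x * g x a * indicator (ival a b) x)) \<and>
     (\<forall>a\<in>J. \<forall>b\<in>J. a \<noteq> b \<longrightarrow> (\<forall>n. chain_mass g n a b < \<infinity>))"

lemma factorization_onD:
  assumes "factorization_on L J g"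
  shows "case_prod g \<in> borel_measurable borel" "0 < g u v" "g u v = g v u"
    and "a \<in> J \<Longrightarrow> b \<in> J \<Longrightarrow> a \<noteq> b \<Longrightarrow>
      L a b x = normalization g a b * g b x * g x a * indicator (ival a b) x"
    and "a \<in> J \<Longrightarrow> b \<in> J \<Longrightarrow> a \<noteq> b \<Longrightarrow> chain_mass g n a b < \<infinity>"
  using assms unfolding factorization_on_def by blast+

lemma factorization_on_subset:
  "factorization_on L J g \<Longrightarrow> K \<subseteq> J \<Longrightarrow> factorization_on L K g"
  unfolding factorization_on_def by blast

abbreviation segment :: "real \<Rightarrow> real \<Rightarrow> real set" where
  "segment a b \<equiv> {min a b..max a b}"

lemma normalization_eq:
  assumes "case_prod g \<in> borel_measurable borel" "\<And>u v. 0 < g u v" "\<And>u v. g u v = g v u"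
  shows "normalization g a b = inverse (enn2real (chain_mass g 1 a b))"
proof -
  have "(LINT y:ival a b|lborel. g b y * g y a) =
      enn2real (\<integral>\<^sup>+y. ennreal (indicator (ival a b) y *\<^sub>R (g b y * g y a)) \<partial>lborel)"
    unfolding set_lebesgue_integral_def
  proof (rule integral_eq_nn_integral)
    show "(\<lambda>y. indicator (ival a b) y *\<^sub>R (g b y * g y a)) \<in> borel_measurable lborel"
      by (intro borel_measurable_scaleR borel_measurable_times measurable_weight[OF assms(1)]
          borel_measurable_indicator) auto
    show "AE y in lborel. 0 \<le> indicator (ival a b) y *\<^sub>R (g b y * g y a)"
      using assms(2) by (simp add: less_imp_le)
  qed
  also have "(\<integral>\<^sup>+y. ennreal (indicator (ival a b) y *\<^sub>R (g b y * g y a)) \<partial>lborel) = chain_mass g 1 a b"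
    using assms(2)
    by (auto intro!: nn_integral_cong simp: indicator_def ennreal_mult less_imp_le mult.commute
        assms(3)[of a] assms(3)[of b])
  finally show ?thesis by (simp add: normalization_def)
qed

lemma chain_mass_enn2real:
  assumes "factorization_on L J g" "a \<in> J" "b \<in> J" "a \<noteq> b"
  shows "ennreal (enn2real (chain_mass g n a b)) = chain_mass g n a b"
    and "0 < enn2real (chain_mass g n a b)"
  using factorization_onD(5)[OF assms] chain_mass_pos[OF factorization_onD(1,2)[OF assms(1)] assms(4), of n]
  by (auto simp: enn2real_positive_iff)

lemma normalization_pos:
  assumes "factorization_on L J g" "a \<in> J" "b \<in> J" "a \<noteq> b"
  shows "0 < normalization g a b"
  unfolding normalization_eq[OF factorization_onD(1-3)[OF assms(1)]]
  by (intro positive_imp_inverse_positive chain_mass_enn2real(2)[OF assms])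

section \<open>The chain density does not depend on the factorization\<close>

definition midpoint_independent :: "real set \<Rightarrow> (real \<Rightarrow> real \<Rightarrow> real) \<Rightarrow> bool" where
  "midpoint_independent J \<rho> \<longleftrightarrow>
     (\<forall>a\<in>J. \<forall>b\<in>J. \<forall>x\<in>ival a b. \<forall>x'\<in>ival a b. \<rho> a x * \<rho> x b = \<rho> a x' * \<rho> x' b)"

lemma midpoint_independentD:
  "midpoint_independent J \<rho> \<Longrightarrow> a \<in> J \<Longrightarrow> b \<in> J \<Longrightarrow> x \<in> ival a b \<Longrightarrow> x' \<in> ival a b \<Longrightarrow>
    \<rho> a x * \<rho> x b = \<rho> a x' * \<rho> x' b"
  unfolding midpoint_independent_def by blast

text \<open>
  The value of \<open>\<rho>(a,x\<^sub>1) \<rho>(x\<^sub>1,x\<^sub>2) \<dots> \<rho>(x\<^sub>n,b)\<close> for one particular chain. Any chain would do: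
  if \<open>\<rho>\<close> is independent of midpoints, the value is the same for all of them.
\<close>

primrec chain_ratio :: "(real \<Rightarrow> real \<Rightarrow> real) \<Rightarrow> nat \<Rightarrow> real \<Rightarrow> real \<Rightarrow> real" where
  "chain_ratio \<rho> 0 a b = \<rho> a b"
| "chain_ratio \<rho> (Suc n) a b = chain_ratio \<rho> n a ((a + b) / 2) * \<rho> ((a + b) / 2) b"

lemma chain_ratio_pos: "(\<And>u v. 0 < \<rho> u v) \<Longrightarrow> 0 < chain_ratio \<rho> n a b"
  by (induction n arbitrary: b) auto

lemma ival_common_point:
  assumes "x \<in> ival a b" "x' \<in> ival a b"
  obtains w where "w \<in> ival a x" "w \<in> ival a x'" "x \<in> ival w b" "x' \<in> ival w b"
  using assms that[of "(a + min x x') / 2"] that[of "(a + max x x') / 2"]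
  by (cases "a < b") (auto simp: mem_ival min_def max_def split: if_splits)

lemma segment_ival: "x \<in> ival a b \<Longrightarrow> segment a x \<subseteq> segment a b" "x \<in> ival a b \<Longrightarrow> segment x b \<subseteq> segment a b"
  by (auto simp: mem_ival min_def max_def split: if_splits)

text \<open>
  Two last sites \<open>x\<close> and \<open>x'\<close> are compared through a common predecessor \<open>w\<close>: the induction
  hypothesis moves the last but one site to \<open>w\<close> in both products, and between \<open>w\<close> and \<open>b\<close> the
  sites \<open>x\<close> and \<open>x'\<close> are interchangeable.
\<close>

lemma chain_ratio_Suc:
  assumes "midpoint_independent (segment c d) \<rho>"
    and "a \<in> segment c d" "b \<in> segment c d" "x \<in> ival a b"
  shows "chain_ratio \<rho> (Suc n) a b = chain_ratio \<rho> n a x * \<rho> x b"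
  using assms(3,4)
proof (induction n arbitrary: b x)
  case 0
  then have "(a + b) / 2 \<in> ival a b"
    by (auto simp: mem_ival min_def max_def split: if_splits)
  with midpoint_independentD[OF assms(1,2) 0(1) this 0(2)] show ?case by simp
next
  case (Suc n)
  define x' where "x' = (a + b) / 2"
  have x': "x' \<in> ival a b" using Suc.prems
    by (auto simp: x'_def mem_ival min_def max_def split: if_splits)
  obtain w where w: "w \<in> ival a x" "w \<in> ival a x'" "x \<in> ival w b" "x' \<in> ival w b"
    using ival_common_point[OF Suc.prems(2) x'] .
  have mem: "x \<in> segment c d" "x' \<in> segment c d"
    using Suc.prems x' assms(2) by (auto simp: mem_ival min_def max_def split: if_splits)
  then have "w \<in> segment c d"
    using w assms(2) by (auto simp: mem_ival min_def max_def split: if_splits)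
  from midpoint_independentD[OF assms(1) this Suc.prems(1) w(3,4)]
  have "chain_ratio \<rho> n a w * \<rho> w x * \<rho> x b = chain_ratio \<rho> n a w * \<rho> w x' * \<rho> x' b"
    by (simp add: mult.assoc)
  then have "chain_ratio \<rho> (Suc n) a x * \<rho> x b = chain_ratio \<rho> (Suc n) a x' * \<rho> x' b"
    unfolding Suc.IH[OF mem(1) w(1)] Suc.IH[OF mem(2) w(2)] .
  then show ?case unfolding chain_ratio.simps(2)[of \<rho> "Suc n"] x'_def by simp
qed

lemma path_weight_chain_ratio:
  assumes "midpoint_independent (segment c d) \<rho>"
    and "\<And>u v. g u v = \<rho> u v * g' u v"
    and "a \<in> segment c d" "b \<in> segment c d"
  shows "path_weight g p n a b \<theta> = chain_ratio \<rho> n a b * path_weight g' p n a b \<theta>"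
  using assms(4)
proof (induction n arbitrary: b)
  case 0
  show ?case using assms(2) by simp
next
  case (Suc n)
  define y where "y = \<theta> (p + Suc n)"
  show ?case
  proof (cases "y \<in> ival a b")
    case True
    then have "y \<in> segment c d"
      using Suc.prems assms(3) by (auto simp: mem_ival min_def max_def split: if_splits)
    moreover have "chain_ratio \<rho> (Suc n) a b = chain_ratio \<rho> n a y * \<rho> y b"
      by (rule chain_ratio_Suc[OF assms(1,3) Suc.prems True])
    ultimately show ?thesis
      unfolding path_weight.simps y_def[symmetric] using Suc.IH[of y] assms(2)[of y b] by simp
  next
    case False
    then show ?thesis unfolding path_weight.simps y_def[symmetric] by simp
  qed
qed

definition site_density :: "(real \<Rightarrow> real \<Rightarrow> real) \<Rightarrow> dens_family" where
  "site_density g n a b \<theta> = path_weight g 0 n a b \<theta> / enn2real (chain_mass g n a b)"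

text \<open>
  The product form of the one-site density makes the quotient of two factorizations independent of
  midpoints. Hence their chain weights differ by a factor that is constant on all chains from \<open>a\<close>
  to \<open>b\<close>, and normalizing cancels this factor.
\<close>

lemma site_density_unique:
  assumes "factorization_on L (segment a b) g" "factorization_on L (segment a b) g'"
  shows "site_density g n a b \<theta> = site_density g' n a b \<theta>"
proof -
  note g = factorization_onD[OF assms(1)] and g' = factorization_onD[OF assms(2)]
  define \<rho> where "\<rho> u v = g u v / g' u v" for u v
  have \<rho>_pos: "0 < \<rho> u v" for u v using g(2) g'(2) by (simp add: \<rho>_def)
  have \<rho>: "\<rho> c x * \<rho> x d = normalization g' c d / normalization g c d"
    if "c \<in> segment a b" "d \<in> segment a b" "x \<in> ival c d" for c d x
  proof -
    have "c \<noteq> d" using that(3) by (auto simp: mem_ival)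
    then have "normalization g c d * g d x * g x c = normalization g' c d * g' d x * g' x c"
      using g(4)[OF that(1,2), of x] g'(4)[OF that(1,2), of x] that(3) by simp
    moreover have "0 < normalization g c d"
      by (rule normalization_pos[OF assms(1) that(1,2) \<open>c \<noteq> d\<close>])
    ultimately show ?thesis
      using g'(2)[of c x] g'(2)[of x d] g(3)[of c x] g(3)[of x d] g'(3)[of c x] g'(3)[of x d]
      by (simp add: \<rho>_def field_simps)
  qed
  have ratio: "path_weight g 0 n a b \<theta> = chain_ratio \<rho> n a b * path_weight g' 0 n a b \<theta>" for \<theta>
  proof (rule path_weight_chain_ratio)
    show "midpoint_independent (segment a b) \<rho>"
      unfolding midpoint_independent_def using \<rho> by metis
    show "g u v = \<rho> u v * g' u v" for u v using g'(2)[of u v] by (simp add: \<rho>_def)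
  qed auto
  have "chain_mass g n a b = ennreal (chain_ratio \<rho> n a b) * chain_mass g' n a b"
  proof -
    have "(\<lambda>\<theta>. ennreal (path_weight g' 0 n a b \<theta>)) \<in> borel_measurable (leb {0+1..0+n})"
      by (intro measurable_compose[OF _ measurable_ennreal] measurable_path_weight[OF g'(1)]) measurable
    then show ?thesis
      unfolding nn_integral_path_weight[OF g(1,2), of 0, symmetric]
        nn_integral_path_weight[OF g'(1,2), of 0, symmetric] ratio
      using chain_ratio_pos[of \<rho> n a b] \<rho>_pos path_weight_nonneg[of g'] g'(2)
      by (simp add: ennreal_mult less_imp_le nn_integral_cmult)
  qed
  then show ?thesis
    using chain_ratio_pos[of \<rho> n a b] \<rho>_pos
    by (simp add: site_density_def ratio enn2real_mult less_imp_le)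
qed

section \<open>The Markov family built from factorizations\<close>

text \<open>
  The choice of \<open>g\<close> depends on \<open>a\<close> and \<open>b\<close>, since no single \<open>g\<close> is given for all positive
  endpoints. The case \<open>n = 0\<close> covers endpoints for which there may be no factorization to choose.
\<close>

definition chain_family :: "(real \<Rightarrow> real \<Rightarrow> real \<Rightarrow> real) \<Rightarrow> dens_family" where
  "chain_family L n a b \<theta> =
     (if n = 0 then 1 else site_density (SOME g. factorization_on L (segment a b) g) n a b \<theta>)"

lemma chain_family_eq:
  assumes "factorization_on L (segment a b) g"
  shows "chain_family L n a b \<theta> = site_density g n a b \<theta>"
proof (cases "n = 0")
  case True
  then show ?thesis
    using factorization_onD(2)[OF assms, of a b] by (simp add: chain_family_def site_density_def)
next
  case False
  then show ?thesis
    unfolding chain_family_def using site_density_unique[OF someI[of "factorization_on L (segment a b)", OF assms] assms]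
    by simp
qed

lemma ennreal_site_density:
  assumes g: "factorization_on L (segment a b) g" and "a \<noteq> b"
  shows "ennreal (site_density g n a b \<theta>) = ennreal (path_weight g 0 n a b \<theta>) / chain_mass g n a b"
proof -
  have "a \<in> segment a b" "b \<in> segment a b" by auto
  note c = chain_mass_enn2real[OF g this \<open>a \<noteq> b\<close>, of n]
  show ?thesis
    unfolding site_density_def
    using divide_ennreal[OF path_weight_nonneg[of g, OF factorization_onD(2)[OF g]] c(2)] c(1)
    by metis
qed

lemma prob_density_site_density:
  assumes g: "factorization_on L (segment a b) g" and "a \<noteq> b"
  shows "prob_density_on (leb {1..n}) (cube n (ival a b)) (site_density g n a b)"
proof -
  note fg = factorization_onD[OF g]
  note pos = path_weight_nonneg[of g, OF fg(2)]
  have ab: "a \<in> segment a b" "b \<in> segment a b" by auto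
  note c = chain_mass_enn2real[OF g ab \<open>a \<noteq> b\<close>, of n]
  have meas: "path_weight g 0 n a b \<in> borel_measurable (leb {1..n})"
    by (rule measurable_path_weight[OF fg(1), where \<theta>="\<lambda>x. x"]) measurable
  have "site_density g n a b \<theta> = 0" if "\<theta> \<in> space (leb {1..n}) - cube n (ival a b)" for \<theta>
  proof -
    have "\<exists>i\<in>{1..n}. \<theta> i \<notin> ival a b"
      using that by (auto simp: space_PiM PiE_iff)
    then obtain i where "i \<in> {1..n}" "\<theta> i \<notin> ival a b" ..
    then show ?thesis using path_weight_eq_0[of i n \<theta> 0 a b g] by (simp add: site_density_def)
  qed
  moreover have "(\<integral>\<^sup>+\<theta>. ennreal (site_density g n a b \<theta>) \<partial>leb {1..n}) = 1"
  proof -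
    have "(\<integral>\<^sup>+\<theta>. ennreal (site_density g n a b \<theta>) \<partial>leb {1..n}) =
        (\<integral>\<^sup>+\<theta>. ennreal (path_weight g 0 n a b \<theta>) / chain_mass g n a b \<partial>leb {1..n})"
      unfolding ennreal_site_density[OF assms] ..
    also have "\<dots> = chain_mass g n a b / chain_mass g n a b"
      using meas nn_integral_path_weight[OF fg(1,2), of 0 n a b] by (simp add: nn_integral_divide)
    also have "\<dots> = 1"
      using c fg(5)[OF ab \<open>a \<noteq> b\<close>, of n] by (intro ennreal_divide_self) auto
    finally show ?thesis .
  qed
  moreover have "site_density g n a b \<in> borel_measurable (leb {1..n})"
    unfolding site_density_def[abs_def] using meas by measurable
  moreover have "0 \<le> site_density g n a b \<theta>" for \<theta>
    using pos[of 0 n a b \<theta>] c(2) by (simp add: site_density_def)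
  ultimately show ?thesis unfolding prob_density_on_def by blast
qed

lemma marginal_site_density:
  assumes g: "factorization_on L (segment a b) g" and "t \<in> ival a b"
  shows "marginal (j + Suc k) (Suc j) (site_density g (j + Suc k) a b) t =
     chain_mass g j a t * chain_mass g k t b / chain_mass g (j + Suc k) a b"
proof -
  note fg = factorization_onD[OF g]
  have ab: "a \<in> segment a b" "b \<in> segment a b" "a \<noteq> b"
    using assms(2) by (auto simp: mem_ival)
  have meas: "(\<lambda>\<omega>. path_weight g 0 (j + Suc k) a b (fun_upd \<omega> (Suc j) t)) \<in>
      borel_measurable (leb ({1..j + Suc k} - {Suc j}))"
  proof (rule measurable_path_weight[OF fg(1)])
    fix i assume "1 \<le> i" "i \<le> j + Suc k"
    then show "(\<lambda>\<omega>. (fun_upd \<omega> (Suc j) t) (0 + i)) \<in>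
        borel_measurable (leb ({1..j + Suc k} - {Suc j}))"
      by (cases "i = Suc j") auto
  qed auto
  have "marginal (j + Suc k) (Suc j) (site_density g (j + Suc k) a b) t =
      (\<integral>\<^sup>+\<omega>. ennreal (path_weight g 0 (j + Suc k) a b (fun_upd \<omega> (Suc j) t)) /
         chain_mass g (j + Suc k) a b \<partial>leb ({1..j + Suc k} - {Suc j}))"
    unfolding marginal_def ennreal_site_density[OF g ab(3)] ..
  also have "\<dots> = chain_mass g j a t * chain_mass g k t b / chain_mass g (j + Suc k) a b"
    using meas nn_integral_path_weight_fixed_site[OF fg(1,2), of j k a b t] assms(2)
    by (simp add: nn_integral_divide)
  finally show ?thesis .
qed

text \<open>
  Conditioning on one site divides the chain weight by the chain masses of the two halves, which
  normalizes each half.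
\<close>

lemma cond_density_site_density:
  assumes g: "factorization_on L (segment a b) g" and t: "\<theta> (Suc j) \<in> ival a b"
  shows "cond_density (j + Suc k) (Suc j) (site_density g (j + Suc k) a b) \<theta> =
     ennreal (site_density g j a (\<theta> (Suc j)) \<theta> *
              site_density g k (\<theta> (Suc j)) b (\<lambda>i. \<theta> (Suc j + i)))"
proof -
  define t where "t = \<theta> (Suc j)"
  note fg = factorization_onD[OF g]
  note nonneg = path_weight_nonneg[of g, OF fg(2)]
  have mem: "a \<in> segment a b" "b \<in> segment a b" "a \<noteq> b" "t \<in> segment a b" "a \<noteq> t" "t \<noteq> b"
    using assms(2) by (auto simp: mem_ival t_def min_def max_def split: if_splits)
  note c = chain_mass_enn2real[OF g mem(1,2,3), of "j + Suc k"]
    and c1 = chain_mass_enn2real[OF g mem(1,4,5), of j]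
    and c2 = chain_mass_enn2real[OF g mem(4,2,6), of k]
  define C C1 C2 where "C = enn2real (chain_mass g (j + Suc k) a b)"
    and "C1 = enn2real (chain_mass g j a t)" and "C2 = enn2real (chain_mass g k t b)"
  have marg: "marginal (j + Suc k) (Suc j) (site_density g (j + Suc k) a b) t = ennreal (C1 * C2 / C)"
  proof -
    have "chain_mass g (j + Suc k) a b = ennreal C" "0 < C"
      "chain_mass g j a t = ennreal C1" "0 < C1" "chain_mass g k t b = ennreal C2" "0 < C2"
      unfolding C_def C1_def C2_def using c c1 c2 by simp_all
    then show ?thesis
      unfolding marginal_site_density[OF g t[folded t_def]]
      by (simp add: divide_ennreal ennreal_mult[symmetric])
  qed
  define W1 W2 where "W1 = path_weight g 0 j a t \<theta>" and "W2 = path_weight g (Suc j) k t b \<theta>"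
  have W: "path_weight g 0 (j + Suc k) a b \<theta> = W1 * W2"
    using path_weight_split[of g 0 j k a b \<theta>] t by (simp add: t_def W1_def W2_def)
  have "cond_density (j + Suc k) (Suc j) (site_density g (j + Suc k) a b) \<theta> =
      ennreal (W1 * W2 / C) / ennreal (C1 * C2 / C)"
    by (simp only: cond_density_def marg[unfolded t_def] site_density_def[of g _ a b] W C_def)
  also have "\<dots> = ennreal ((W1 * W2 / C) / (C1 * C2 / C))"
    using c(2) c1(2) c2(2) nonneg by (intro divide_ennreal) (simp_all add: W1_def W2_def C_def C1_def C2_def)
  also have "(W1 * W2 / C) / (C1 * C2 / C) = (W1 / C1) * (W2 / C2)"
    using c(2) by (simp add: C_def)
  also have "W2 = path_weight g 0 k t b (\<lambda>i. \<theta> (Suc j + i))"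
    unfolding W2_def by (rule path_weight_cong) simp
  finally show ?thesis
    by (simp only: site_density_def[of g j] site_density_def[of g k] t_def W1_def C1_def C2_def)
qed

theorem chain_family_markov:
  assumes ex: "\<And>a b. 0 < a \<Longrightarrow> 0 < b \<Longrightarrow> \<exists>g. factorization_on L (segment a b) g"
  shows "density_family (chain_family L)" "symmetric_family (chain_family L)"
    "two_sided_markov (chain_family L)" "has_one_site_density (chain_family L) L"
proof -
  have one_site: "chain_family L 1 a b (pt1 x) = L a b x"
    if "0 < a" "0 < b" "a \<noteq> b" for a b x
  proof -
    obtain g where g: "factorization_on L (segment a b) g" using ex \<open>0 < a\<close> \<open>0 < b\<close> by blast
    note fg = factorization_onD[OF g]
    have "a \<in> segment a b" "b \<in> segment a b" by auto
    from fg(4)[OF this \<open>a \<noteq> b\<close>] show ?thesis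
      unfolding chain_family_eq[OF g] site_density_def normalization_eq[OF fg(1-3)]
      by (simp add: pt1_def divide_inverse fg(3)[of a] fg(3)[of _ b] mult_ac)
  qed
  then show "has_one_site_density (chain_family L) L"
    by (simp add: has_one_site_density_def)
  show "density_family (chain_family L)"
    unfolding density_family_def
  proof (intro conjI allI impI)
    fix n :: nat and a b :: real assume "1 \<le> n" "0 < a" "0 < b" "a \<noteq> b"
    obtain g where g: "factorization_on L (segment a b) g" using ex \<open>0 < a\<close> \<open>0 < b\<close> by blast
    have "chain_family L n a b = site_density g n a b"
      by (rule ext) (rule chain_family_eq[OF g])
    then show "prob_density_on (leb {1..n}) (cube n (ival a b)) (chain_family L n a b)"
      using prob_density_site_density[OF g \<open>a \<noteq> b\<close>] by simp
  qed (simp add: chain_family_def)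
  show "symmetric_family (chain_family L)"
    unfolding symmetric_family_def
  proof (intro allI impI ballI)
    fix n :: nat and a b :: real and \<theta> assume "1 \<le> n" "0 < a" "0 < b" "a \<noteq> b"
    obtain g where g: "factorization_on L (segment a b) g" using ex \<open>0 < a\<close> \<open>0 < b\<close> by blast
    then have g': "factorization_on L (segment b a) g" by (simp add: min.commute max.commute)
    note fg = factorization_onD[OF g]
    have "path_weight g 0 n a b \<theta> = path_weight g 0 n b a (\<lambda>i\<in>{1..n}. \<theta> (n + 1 - i))"
      by (rule path_weight_rev[OF fg(3)]) auto
    then show "chain_family L n a b \<theta> = chain_family L n b a (\<lambda>i\<in>{1..n}. \<theta> (n + 1 - i))"
      unfolding chain_family_eq[OF g] chain_family_eq[OF g']
      by (simp add: site_density_def chain_mass_commute[OF fg(1-3), of n a b])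
  qed
  show "two_sided_markov (chain_family L)"
    unfolding two_sided_markov_def
  proof (intro allI impI conjI ballI)
    fix n :: nat and a b :: real and j \<theta>
    assume ab: "0 < a" "0 < b" "a \<noteq> b" and j: "j \<in> {1..n}" and \<theta>: "\<theta> \<in> cube n (ival a b)"
    define i k where "i = j - 1" and "k = n - j"
    then have i: "j = Suc i" and n: "n = i + Suc k"
      using j by auto
    obtain g where g: "factorization_on L (segment a b) g" using ex \<open>0 < a\<close> \<open>0 < b\<close> by blast
    have t: "\<theta> (Suc i) \<in> ival a b" using \<theta> j i by auto
    have g1: "factorization_on L (segment a (\<theta> (Suc i))) g"
      and g2: "factorization_on L (segment (\<theta> (Suc i)) b) g"
      using factorization_on_subset[OF g] segment_ival[OF t] by auto
    have fam: "chain_family L n a b = site_density g n a b"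
      by (rule ext) (rule chain_family_eq[OF g])
    have "path_weight g 0 i a (\<theta> (Suc i)) (\<lambda>m\<in>{1..i}. \<theta> m) = path_weight g 0 i a (\<theta> (Suc i)) \<theta>"
      by (rule path_weight_cong) auto
    moreover have "path_weight g 0 k (\<theta> (Suc i)) b (\<lambda>m\<in>{1..k}. \<theta> (Suc i + m)) =
        path_weight g 0 k (\<theta> (Suc i)) b (\<lambda>m. \<theta> (Suc i + m))"
      by (rule path_weight_cong) auto
    ultimately show "cond_density n j (chain_family L n a b) \<theta> =
       ennreal (chain_family L (j - 1) a (\<theta> j) (\<lambda>i\<in>{1..j - 1}. \<theta> i) *
                chain_family L (n - j) (\<theta> j) b (\<lambda>i\<in>{1..n - j}. \<theta> (j + i)))"
      unfolding fam using cond_density_site_density[of L a b g \<theta> i k, OF g t]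
      by (simp add: i n chain_family_eq[OF g1] chain_family_eq[OF g2] site_density_def)
  next
    fix a b :: real assume ab: "0 < a" "0 < b" "a \<noteq> b"
    obtain g where g: "factorization_on L (segment a b) g" using ex \<open>0 < a\<close> \<open>0 < b\<close> by blast
    have "0 < normalization g a b"
      by (rule normalization_pos[OF g _ _ ab(3)]) auto
    then show "{x. chain_family L 1 a b (pt1 x) \<noteq> 0} = ival a b"
      unfolding one_site[OF ab]
      using factorization_onD(2)[OF g]
      by (auto simp: factorization_onD(4)[OF g _ _ ab(3)] indicator_def less_imp_neq[symmetric])
  qed
qed

section \<open>Marginals that determine each other vanish nowhere\<close>

text \<open>
  The hypotheses say that \<open>q\<close> does not vanish at \<open>(x,y)\<close> as soon as one of the marginals \<open>s\<close>, \<open>r\<close> does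
  not vanish at \<open>x\<close> or \<open>y\<close>. So a zero of \<open>r\<close> at \<open>y\<close> makes \<open>s\<close> vanish almost everywhere on \<open>(a,y)\<close>, in
  particular arbitrarily close to \<open>a\<close>; and a zero of \<open>s\<close> at \<open>x\<close> makes \<open>r\<close> vanish almost everywhere
  on \<open>(x,b)\<close>. Together \<open>r\<close> would vanish almost everywhere, contradicting the total mass.
\<close>

lemma bivariate_marginals_positive:
  fixes q :: "real \<Rightarrow> real \<Rightarrow> ennreal"
  assumes meas: "case_prod q \<in> borel_measurable (borel \<Otimes>\<^sub>M borel)"
    and s: "\<And>x. s x = (\<integral>\<^sup>+y. q x y \<partial>lborel)" and r: "\<And>y. r y = (\<integral>\<^sup>+x. q x y \<partial>lborel)"
    and s_pos: "\<And>x y. a < x \<Longrightarrow> x < y \<Longrightarrow> y < b \<Longrightarrow> s x \<noteq> 0 \<Longrightarrow> q x y \<noteq> 0"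
    and r_pos: "\<And>x y. a < x \<Longrightarrow> x < y \<Longrightarrow> y < b \<Longrightarrow> r y \<noteq> 0 \<Longrightarrow> q x y \<noteq> 0"
    and outside: "\<And>y. y \<le> a \<or> b \<le> y \<Longrightarrow> r y = 0"
    and total: "(\<integral>\<^sup>+y. r y \<partial>lborel) \<noteq> 0"
    and "a < y" "y < b"
  shows "r y \<noteq> 0" "s y \<noteq> 0"
proof -
  have meas_x: "(\<lambda>x. q x y) \<in> borel_measurable lborel" for y
    using measurable_compose[OF _ meas, of "\<lambda>x. (x, y)" lborel] by simp
  have meas_y: "(\<lambda>y. q x y) \<in> borel_measurable lborel" for x
    using measurable_compose[OF _ meas, of "\<lambda>y. (x, y)" lborel] by simp
  have r0: "AE x in lborel. a < x \<and> x < y \<longrightarrow> s x = 0" if "r y = 0" "y < b" for y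
  proof -
    have "AE x in lborel. q x y = 0"
      using that(1) meas_x by (simp add: r nn_integral_0_iff_AE)
    then show ?thesis
      by (rule AE_mp) (use s_pos that(2) in auto)
  qed
  have s0: "AE y in lborel. x < y \<and> y < b \<longrightarrow> r y = 0" if "s x = 0" "a < x" for x
  proof -
    have "AE y in lborel. q x y = 0"
      using that(1) meas_y by (simp add: s nn_integral_0_iff_AE)
    then show ?thesis
      by (rule AE_mp) (use r_pos that(2) in auto)
  qed
  have r: "r y \<noteq> 0" if y: "a < y" "y < b" for y
  proof
    assume "r y = 0"
    note s_AE = r0[OF this y(2)]
    \<comment> \<open>Only rational \<open>c\<close> are used, so that the exceptional null sets are countably many.\<close>
    have "AE y' in lborel. of_rat c < y' \<and> y' < b \<longrightarrow> r y' = 0" if c: "a < of_rat c" "of_rat c < y" for c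
    proof -
      have "AE x in lborel. x \<in> ival a (of_rat c) \<longrightarrow> s x = 0"
        using s_AE by (rule AE_mp) (use c in \<open>auto simp: mem_ival\<close>)
      from AE_ival_imp_ex[OF _ this] c obtain x where x: "x \<in> ival a (of_rat c)" "s x = 0"
        by auto
      then have "a < x" "x < of_rat c" using c by (auto simp: mem_ival)
      show ?thesis
        using s0[OF x(2) \<open>a < x\<close>] by (rule AE_mp) (use \<open>x < of_rat c\<close> in auto)
    qed
    then have "AE y' in lborel. \<forall>c::rat. a < of_rat c \<and> of_rat c < y \<longrightarrow>
        (of_rat c < y' \<and> y' < b \<longrightarrow> r y' = 0)"
      unfolding AE_all_countable by (intro allI AE_impI) auto
    then have "AE y' in lborel. r y' = 0"
    proof (rule AE_mp, intro AE_I2 impI)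
      fix y'
      assume *: "\<forall>c::rat. a < of_rat c \<and> of_rat c < y \<longrightarrow> (of_rat c < y' \<and> y' < b \<longrightarrow> r y' = 0)"
      show "r y' = 0"
      proof (cases "a < y' \<and> y' < b")
        case True
        obtain c where "a < of_rat c" "of_rat c < min y y'"
          using of_rat_dense[of a "min y y'"] True y by auto
        with * True show ?thesis by auto
      next
        case False
        then show ?thesis using outside by auto
      qed
    qed
    then have "(\<integral>\<^sup>+y. r y \<partial>lborel) = (\<integral>\<^sup>+y. 0 \<partial>(lborel :: real measure))"
      by (rule nn_integral_cong_AE)
    with total show False by simp
  qed
  show "r y \<noteq> 0" using r \<open>a < y\<close> \<open>y < b\<close> .
  show "s y \<noteq> 0"
  proof
    assume "s y = 0"
    from s0[OF this \<open>a < y\<close>] have "AE z in lborel. z \<in> ival y b \<longrightarrow> r z = 0"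
      by (rule AE_mp) (use \<open>y < b\<close> in \<open>auto simp: mem_ival\<close>)
    from AE_ival_imp_ex[OF _ this] \<open>y < b\<close> obtain z where "z \<in> ival y b" "r z = 0"
      by auto
    then show False using r[of z] \<open>a < y\<close> \<open>y < b\<close> by (auto simp: mem_ival)
  qed
qed

section \<open>The last two sites of a Markov family\<close>

text \<open>
  In the extended reals, division by \<open>\<infinity>\<close> gives 0. So a nonzero conditional density shows that the
  marginal is finite.
\<close>

lemma ennreal_divide_eqD:
  fixes q s :: ennreal
  assumes "q / s = l" "s \<noteq> 0" "l \<noteq> 0"
  shows "s \<noteq> top" "q = s * l"
proof -
  show "s \<noteq> top" using assms by auto
  then have "s * (q / s) = q"
    using mult_divide_eq_ennreal[OF assms(2), of q] by (simp add: ennreal_times_divide mult.commute)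
  with assms(1) show "q = s * l" by simp
qed

locale markov_family =
  fixes \<Lambda> :: dens_family and L :: "real \<Rightarrow> real \<Rightarrow> real \<Rightarrow> real"
  assumes L: "one_site_density L"
    and family: "density_family \<Lambda>"
    and symmetric: "symmetric_family \<Lambda>"
    and markov: "two_sided_markov \<Lambda>"
    and one_site: "has_one_site_density \<Lambda> L"
begin

lemma L_density:
  assumes "0 < a" "0 < b" "a \<noteq> b"
  shows "L a b \<in> borel_measurable lborel" "0 \<le> L a b x" "x \<notin> ival a b \<Longrightarrow> L a b x = 0"
    "(\<integral>\<^sup>+x. ennreal (L a b x) \<partial>lborel) = 1"
proof -
  have "prob_density_on lborel (ival a b) (L a b)"
    using L assms unfolding one_site_density_def by blast
  then show "L a b \<in> borel_measurable lborel" "0 \<le> L a b x" "x \<notin> ival a b \<Longrightarrow> L a b x = 0"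
    "(\<integral>\<^sup>+x. ennreal (L a b x) \<partial>lborel) = 1"
    unfolding prob_density_on_def by auto
qed

lemma \<Lambda>_1: "0 < a \<Longrightarrow> 0 < b \<Longrightarrow> a \<noteq> b \<Longrightarrow> \<Lambda> 1 a b (pt1 x) = L a b x"
  using one_site unfolding has_one_site_density_def by blast

lemma L_pos:
  assumes "0 < a" "0 < b" "x \<in> ival a b"
  shows "0 < L a b x"
proof -
  have "a \<noteq> b" using assms(3) by (auto simp: mem_ival)
  then have "{x. \<Lambda> 1 a b (pt1 x) \<noteq> 0} = ival a b"
    using markov assms unfolding two_sided_markov_def by (metis order_refl)
  then have "L a b x \<noteq> 0"
    using \<Lambda>_1[OF assms(1,2) \<open>a \<noteq> b\<close>] assms(3) by auto
  then show ?thesis using L_density(2)[OF assms(1,2) \<open>a \<noteq> b\<close>, of x] by simp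
qed

lemma L_commute:
  assumes "0 < a" "0 < b" "a \<noteq> b"
  shows "L a b x = L b a x"
proof (cases "x \<in> ival a b")
  case True
  have "pt1 x \<in> cube 1 (ival a b)" using True by (auto simp: pt1_def)
  then have "\<Lambda> 1 a b (pt1 x) = \<Lambda> 1 b a (\<lambda>i\<in>{1..1}. pt1 x (1 + 1 - i))"
    using symmetric assms unfolding symmetric_family_def by blast
  also have "(\<lambda>i\<in>{1..1}. pt1 x (1 + 1 - i)) = pt1 x"
    by (auto simp: pt1_def fun_eq_iff)
  finally show ?thesis using \<Lambda>_1 assms by simp
next
  case False
  then show ?thesis using L_density(3) assms ival_commute[of a b] by metis
qed

lemma \<Lambda>_0: "\<Lambda> 0 a b \<theta> = 1"
  using family unfolding density_family_def by blast

lemma \<Lambda>_density: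
  assumes "0 < a" "0 < b" "a \<noteq> b"
  shows "\<Lambda> n a b \<in> borel_measurable (leb {1..n})"
    "\<theta> \<in> space (leb {1..n}) \<Longrightarrow> 0 \<le> \<Lambda> n a b \<theta>"
    "\<theta> \<in> space (leb {1..n}) \<Longrightarrow> \<theta> \<notin> cube n (ival a b) \<Longrightarrow> \<Lambda> n a b \<theta> = 0"
    "(\<integral>\<^sup>+\<theta>. ennreal (\<Lambda> n a b \<theta>) \<partial>leb {1..n}) = 1"
proof -
  have *: "\<Lambda> n a b \<in> borel_measurable (leb {1..n}) \<and>
      (\<forall>\<theta>\<in>space (leb {1..n}). 0 \<le> \<Lambda> n a b \<theta>) \<and>
      (\<forall>\<theta>\<in>space (leb {1..n}) - cube n (ival a b). \<Lambda> n a b \<theta> = 0) \<and>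
      (\<integral>\<^sup>+\<theta>. ennreal (\<Lambda> n a b \<theta>) \<partial>leb {1..n}) = 1"
  proof (cases "n = 0")
    case True
    have "\<Lambda> n a b = (\<lambda>\<theta>. 1)" using \<Lambda>_0 True by auto
    then show ?thesis using True by (simp add: PiM_empty)
  next
    case False
    then have "prob_density_on (leb {1..n}) (cube n (ival a b)) (\<Lambda> n a b)"
      using family assms unfolding density_family_def by (metis One_nat_def Suc_leI gr0I)
    then show ?thesis unfolding prob_density_on_def .
  qed
  then show "\<Lambda> n a b \<in> borel_measurable (leb {1..n})"
    "\<theta> \<in> space (leb {1..n}) \<Longrightarrow> 0 \<le> \<Lambda> n a b \<theta>"
    "\<theta> \<in> space (leb {1..n}) \<Longrightarrow> \<theta> \<notin> cube n (ival a b) \<Longrightarrow> \<Lambda> n a b \<theta> = 0"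
    "(\<integral>\<^sup>+\<theta>. ennreal (\<Lambda> n a b \<theta>) \<partial>leb {1..n}) = 1"
    by auto
qed

lemma nn_integral_marginal:
  assumes "0 < a" "0 < b" "a \<noteq> b" "i \<in> {1..n}"
  shows "(\<integral>\<^sup>+t. marginal n i (\<Lambda> n a b) t \<partial>lborel) = 1"
proof -
  have set_eq: "{1..n} = insert i ({1..n} - {i})" using assms(4) by auto
  have meas: "(\<lambda>\<theta>. ennreal (\<Lambda> n a b \<theta>)) \<in> borel_measurable (leb (insert i ({1..n} - {i})))"
    using \<Lambda>_density(1)[OF assms(1-3), of n] set_eq by simp
  have "1 = (\<integral>\<^sup>+\<theta>. ennreal (\<Lambda> n a b \<theta>) \<partial>leb (insert i ({1..n} - {i})))"
    using \<Lambda>_density(4)[OF assms(1-3), of n] set_eq by simp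
  also have "\<dots> = (\<integral>\<^sup>+t. marginal n i (\<Lambda> n a b) t \<partial>lborel)"
    unfolding marginal_def
    by (rule lborel_seq.product_nn_integral_insert_rev) (use meas in auto)
  finally show ?thesis ..
qed

lemma marginal_eq_0:
  assumes "0 < a" "0 < b" "a \<noteq> b" "i \<in> {1..n}" "t \<notin> ival a b"
  shows "marginal n i (\<Lambda> n a b) t = 0"
proof -
  have "\<Lambda> n a b (fun_upd \<omega> i t) = 0" if "\<omega> \<in> space (leb ({1..n} - {i}))" for \<omega>
  proof (rule \<Lambda>_density(3)[OF assms(1-3)])
    show "fun_upd \<omega> i t \<in> space (leb {1..n})"
      using that assms(4) by (auto simp: space_PiM PiE_def extensional_def)
    show "fun_upd \<omega> i t \<notin> cube n (ival a b)"
      using assms(4,5) by (auto simp: PiE_iff)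
  qed
  then have "marginal n i (\<Lambda> n a b) t = (\<integral>\<^sup>+\<omega>. 0 \<partial>leb ({1..n} - {i}))"
    unfolding marginal_def by (intro nn_integral_cong) simp
  then show ?thesis by simp
qed

text \<open>
  The joint density of the last two of \<open>m + 2\<close> sites. Its values are extended reals: that it is
  finite everywhere, and not only almost everywhere, has to be deduced from the Markov property.
\<close>

definition last_two :: "nat \<Rightarrow> real \<Rightarrow> real \<Rightarrow> real \<Rightarrow> real \<Rightarrow> ennreal" where
  "last_two m a b x y =
     (\<integral>\<^sup>+\<omega>. ennreal (\<Lambda> (m + 2) a b (fun_upd (fun_upd \<omega> (m + 1) x) (m + 2) y)) \<partial>leb {1..m})"

lemma measurable_last_two:
  assumes "0 < a" "0 < b" "a \<noteq> b"
  shows "case_prod (last_two m a b) \<in> borel_measurable (borel \<Otimes>\<^sub>M borel)"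
proof -
  have "(\<lambda>z. fun_upd (fun_upd (snd z) (m + 1) (fst (fst z))) (m + 2) (snd (fst z))) \<in>
      measurable ((borel \<Otimes>\<^sub>M borel) \<Otimes>\<^sub>M leb {1..m}) (leb {1..m + 2})"
  proof (rule measurable_fun_upd[where J="{1..m + 1}"])
    show "(\<lambda>z. fun_upd (snd z) (m + 1) (fst (fst z))) \<in>
        measurable ((borel \<Otimes>\<^sub>M borel) \<Otimes>\<^sub>M leb {1..m}) (leb {1..m + 1})"
      by (rule measurable_fun_upd[where J="{1..m}"]) auto
  qed auto
  from measurable_compose[OF this \<Lambda>_density(1)[OF assms]]
  have "(\<lambda>z. ennreal (\<Lambda> (m + 2) a b (fun_upd (fun_upd (snd z) (m + 1) (fst (fst z))) (m + 2) (snd (fst z)))))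
      \<in> borel_measurable ((borel \<Otimes>\<^sub>M borel) \<Otimes>\<^sub>M leb {1..m})"
    by (rule measurable_compose[OF _ measurable_ennreal])
  then have "(\<lambda>z. last_two m a b (fst z) (snd z)) \<in> borel_measurable (borel \<Otimes>\<^sub>M borel)"
    unfolding last_two_def
    by (intro sigma_finite_measure.borel_measurable_nn_integral lborel_seq.sigma_finite)
      (simp_all add: split_beta')
  then show ?thesis by (simp add: split_beta')
qed

lemma marginal_last_but_one:
  assumes "0 < a" "0 < b" "a \<noteq> b"
  shows "marginal (m + 2) (m + 1) (\<Lambda> (m + 2) a b) x = (\<integral>\<^sup>+y. last_two m a b x y \<partial>lborel)"
proof -
  have set_eq: "{1..m + 2} - {m + 1} = insert (m + 2) {1..m}" by auto
  have "(\<lambda>\<omega>. fun_upd \<omega> (m + 1) x) \<in> measurable (leb (insert (m + 2) {1..m})) (leb {1..m + 2})"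
    by (rule measurable_fun_upd[where J="insert (m + 2) {1..m}"]) auto
  from measurable_compose[OF measurable_compose[OF this \<Lambda>_density(1)[OF assms]] measurable_ennreal]
  have meas: "(\<lambda>\<omega>. ennreal (\<Lambda> (m + 2) a b (fun_upd \<omega> (m + 1) x))) \<in>
      borel_measurable (leb (insert (m + 2) {1..m}))" .
  have "marginal (m + 2) (m + 1) (\<Lambda> (m + 2) a b) x =
     (\<integral>\<^sup>+y. \<integral>\<^sup>+\<omega>. ennreal (\<Lambda> (m + 2) a b (fun_upd (fun_upd \<omega> (m + 2) y) (m + 1) x)) \<partial>leb {1..m} \<partial>lborel)"
    unfolding marginal_def set_eq
    by (rule lborel_seq.product_nn_integral_insert_rev) (use meas in auto)
  also have "\<dots> = (\<integral>\<^sup>+y. last_two m a b x y \<partial>lborel)"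
    unfolding last_two_def by (simp add: fun_upd_twist)
  finally show ?thesis .
qed

lemma marginal_last:
  assumes "0 < a" "0 < b" "a \<noteq> b"
  shows "marginal (m + 2) (m + 2) (\<Lambda> (m + 2) a b) y = (\<integral>\<^sup>+x. last_two m a b x y \<partial>lborel)"
proof -
  have set_eq: "{1..m + 2} - {m + 2} = insert (m + 1) {1..m}" by auto
  have "(\<lambda>\<omega>. fun_upd \<omega> (m + 2) y) \<in> measurable (leb (insert (m + 1) {1..m})) (leb {1..m + 2})"
    by (rule measurable_fun_upd[where J="insert (m + 1) {1..m}"]) auto
  from measurable_compose[OF measurable_compose[OF this \<Lambda>_density(1)[OF assms]] measurable_ennreal]
  have meas: "(\<lambda>\<omega>. ennreal (\<Lambda> (m + 2) a b (fun_upd \<omega> (m + 2) y))) \<in>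
      borel_measurable (leb (insert (m + 1) {1..m}))" .
  show ?thesis
    unfolding marginal_def set_eq last_two_def
    by (rule lborel_seq.product_nn_integral_insert_rev) (use meas in auto)
qed

lemma marginal_last_Suc:
  "marginal (m + 1) (m + 1) p x = (\<integral>\<^sup>+\<omega>. ennreal (p (fun_upd \<omega> (m + 1) x)) \<partial>leb {1..m})"
proof -
  have "{1..m + 1} - {m + 1} = {1..m}" by auto
  then show ?thesis by (simp add: marginal_def)
qed

lemma marginal_1:
  assumes "0 < a" "0 < b" "a \<noteq> b"
  shows "marginal 1 1 (\<Lambda> 1 a b) x = ennreal (L a b x)"
proof -
  have "(\<lambda>_. undefined)(1 := x) = pt1 x" by (auto simp: pt1_def fun_eq_iff)
  then show ?thesis using \<Lambda>_1[OF assms] by (simp add: marginal_def PiM_empty nn_integral_count_space_finite)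
qed

lemma markov_cond_density:
  assumes "0 < a" "0 < b" "a \<noteq> b" "j \<in> {1..n}" "\<theta> \<in> cube n (ival a b)"
    and "marginal n j (\<Lambda> n a b) (\<theta> j) \<noteq> 0"
  shows "ennreal (\<Lambda> n a b \<theta>) / marginal n j (\<Lambda> n a b) (\<theta> j) =
     ennreal (\<Lambda> (j - 1) a (\<theta> j) (\<lambda>i\<in>{1..j - 1}. \<theta> i) *
              \<Lambda> (n - j) (\<theta> j) b (\<lambda>i\<in>{1..n - j}. \<theta> (j + i)))"
proof -
  have "1 \<le> n" using assms(4) by simp
  then show ?thesis
    using markov assms unfolding two_sided_markov_def cond_density_def by blast
qed

lemma cube_fun_upd2:
  assumes "\<omega> \<in> space (leb {1..m})"
  shows "fun_upd (fun_upd \<omega> (m + 1) x) (m + 2) y \<in> space (leb {1..m + 2})"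
    and "fun_upd (fun_upd \<omega> (m + 1) x) (m + 2) y \<in> cube (m + 2) A \<longleftrightarrow>
      \<omega> \<in> cube m A \<and> x \<in> A \<and> y \<in> A"
proof -
  show "fun_upd (fun_upd \<omega> (m + 1) x) (m + 2) y \<in> space (leb {1..m + 2})"
    using assms by (auto simp: space_PiM PiE_def extensional_def)
  have "(\<forall>i\<in>{1..m + 2}. fun_upd (fun_upd \<omega> (m + 1) x) (m + 2) y i \<in> A) \<longleftrightarrow>
      (\<forall>i\<in>{1..m}. \<omega> i \<in> A) \<and> x \<in> A \<and> y \<in> A" (is "(\<forall>i\<in>_. ?\<theta> i \<in> A) \<longleftrightarrow> _")
  proof -
    have "{1..m + 2} = {1..m} \<union> {m + 1, m + 2}" by auto
    then show ?thesis by auto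
  qed
  then show "fun_upd (fun_upd \<omega> (m + 1) x) (m + 2) y \<in> cube (m + 2) A \<longleftrightarrow>
      \<omega> \<in> cube m A \<and> x \<in> A \<and> y \<in> A"
    using assms by (auto simp: space_PiM PiE_iff extensional_def)
qed

lemma measurable_fun_upd2:
  assumes "0 < a" "0 < b" "a \<noteq> b"
  shows "(\<lambda>\<omega>. ennreal (\<Lambda> (m + 2) a b (fun_upd (fun_upd \<omega> (m + 1) x) (m + 2) y))) \<in>
      borel_measurable (leb {1..m})"
proof -
  have "(\<lambda>\<omega>. fun_upd (fun_upd \<omega> (m + 1) x) (m + 2) y) \<in> measurable (leb {1..m}) (leb {1..m + 2})"
  proof (rule measurable_fun_upd[where J="{1..m + 1}"])
    show "(\<lambda>\<omega>. fun_upd \<omega> (m + 1) x) \<in> measurable (leb {1..m}) (leb {1..m + 1})"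
      by (rule measurable_fun_upd[where J="{1..m}"]) auto
  qed auto
  from measurable_compose[OF measurable_compose[OF this \<Lambda>_density(1)[OF assms]] measurable_ennreal]
  show ?thesis .
qed

text \<open>
  The Markov property at site \<open>m + 1\<close>, with the first \<open>m\<close> sites integrated out: given their right
  neighbour \<open>x\<close> they form a density, so only the one-site density between \<open>x\<close> and \<open>b\<close> remains.
\<close>

lemma last_two_given_last_but_one:
  assumes ab: "0 < a" "0 < b" "a \<noteq> b" and xy: "x \<in> ival a b" "y \<in> ival a b"
    and nz: "marginal (m + 2) (m + 1) (\<Lambda> (m + 2) a b) x \<noteq> 0"
  shows "last_two m a b x y / marginal (m + 2) (m + 1) (\<Lambda> (m + 2) a b) x = ennreal (L x b y)"
proof -
  define M where "M = marginal (m + 2) (m + 1) (\<Lambda> (m + 2) a b) x"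
  have x: "0 < x" "a \<noteq> x" "x \<noteq> b" using xy ab by (auto simp: mem_ival min_def split: if_splits)
  have *: "ennreal (\<Lambda> (m + 2) a b (fun_upd (fun_upd \<omega> (m + 1) x) (m + 2) y)) / M =
      ennreal (\<Lambda> m a x \<omega>) * ennreal (L x b y)" if \<omega>: "\<omega> \<in> space (leb {1..m})" for \<omega>
  proof -
    define \<theta> where "\<theta> = fun_upd (fun_upd \<omega> (m + 1) x) (m + 2) y"
    show ?thesis
    proof (cases "\<omega> \<in> cube m (ival a b)")
      case True
      then have "\<theta> \<in> cube (m + 2) (ival a b)"
        using cube_fun_upd2(2)[OF \<omega>] xy by (simp add: \<theta>_def)
      moreover have "\<theta> (m + 1) = x" by (simp add: \<theta>_def)
      moreover have "(\<lambda>i\<in>{1..m}. \<theta> i) = \<omega>"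
        using \<omega> by (auto simp: \<theta>_def space_PiM PiE_def extensional_def fun_eq_iff)
      moreover have "(\<lambda>i\<in>{1..1}. \<theta> (m + 1 + i)) = pt1 y"
        by (auto simp: \<theta>_def pt1_def fun_eq_iff)
      ultimately have "ennreal (\<Lambda> (m + 2) a b \<theta>) / M = ennreal (\<Lambda> m a x \<omega> * \<Lambda> 1 x b (pt1 y))"
        using markov_cond_density[OF ab, of "m + 1" "m + 2" \<theta>] nz by (simp add: M_def)
      then show ?thesis
        using \<Lambda>_1[OF x(1) ab(2) x(3)] \<Lambda>_density(2)[OF ab(1) x(1,2) \<omega>]
          L_density(2)[OF x(1) ab(2) x(3), of y]
        by (simp add: \<theta>_def ennreal_mult)
    next
      case False
      then have "\<Lambda> (m + 2) a b \<theta> = 0"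
        using \<Lambda>_density(3)[OF ab cube_fun_upd2(1)[OF \<omega>]] cube_fun_upd2(2)[OF \<omega>] by (simp add: \<theta>_def)
      moreover have "ival a x \<subseteq> ival a b"
        using xy(1) by (auto simp: mem_ival min_def max_def split: if_splits)
      then have "\<omega> \<notin> cube m (ival a x)"
        using False PiE_mono[of "{1..m}" "\<lambda>_. ival a x" "\<lambda>_. ival a b"] by blast
      ultimately show ?thesis
        using \<Lambda>_density(3)[OF ab(1) x(1,2) \<omega>] by (simp add: \<theta>_def)
    qed
  qed
  have "last_two m a b x y / M =
      (\<integral>\<^sup>+\<omega>. ennreal (\<Lambda> m a x \<omega>) * ennreal (L x b y) \<partial>leb {1..m})"
    unfolding last_two_def nn_integral_divide[OF measurable_fun_upd2[OF ab], symmetric]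
    by (rule nn_integral_cong) (rule *)
  also have "\<dots> = ennreal (L x b y)"
    using \<Lambda>_density(1,4)[OF ab(1) x(1,2), of m] by (simp add: nn_integral_multc)
  finally show ?thesis by (simp add: M_def)
qed

text \<open>
  The Markov property at the last site: given its value \<open>y\<close>, the other sites are distributed as
  those of the family between \<open>a\<close> and \<open>y\<close>.
\<close>

lemma last_two_given_last:
  assumes ab: "0 < a" "0 < b" "a \<noteq> b" and xy: "x \<in> ival a b" "y \<in> ival a b"
    and nz: "marginal (m + 2) (m + 2) (\<Lambda> (m + 2) a b) y \<noteq> 0"
  shows "last_two m a b x y / marginal (m + 2) (m + 2) (\<Lambda> (m + 2) a b) y =
     marginal (m + 1) (m + 1) (\<Lambda> (m + 1) a y) x"
proof -
  define M where "M = marginal (m + 2) (m + 2) (\<Lambda> (m + 2) a b) y"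
  have y: "0 < y" "a \<noteq> y" "y \<noteq> b" using xy ab by (auto simp: mem_ival min_def split: if_splits)
  have *: "ennreal (\<Lambda> (m + 2) a b (fun_upd (fun_upd \<omega> (m + 1) x) (m + 2) y)) / M =
      ennreal (\<Lambda> (m + 1) a y (fun_upd \<omega> (m + 1) x))" if \<omega>: "\<omega> \<in> space (leb {1..m})" for \<omega>
  proof -
    define \<theta> where "\<theta> = fun_upd (fun_upd \<omega> (m + 1) x) (m + 2) y"
    show ?thesis
    proof (cases "\<omega> \<in> cube m (ival a b)")
      case True
      then have "\<theta> \<in> cube (m + 2) (ival a b)"
        using cube_fun_upd2(2)[OF \<omega>] xy by (simp add: \<theta>_def)
      moreover have "\<theta> (m + 2) = y" by (simp add: \<theta>_def)
      moreover have "(\<lambda>i\<in>{1..m + 1}. \<theta> i) = fun_upd \<omega> (m + 1) x"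
        using \<omega> by (auto simp: \<theta>_def space_PiM PiE_def extensional_def fun_eq_iff)
      ultimately show ?thesis
        using markov_cond_density[OF ab, of "m + 2" "m + 2" \<theta>] nz by (simp add: M_def \<Lambda>_0 \<theta>_def)
    next
      case False
      then have "\<Lambda> (m + 2) a b \<theta> = 0"
        using \<Lambda>_density(3)[OF ab cube_fun_upd2(1)[OF \<omega>]] cube_fun_upd2(2)[OF \<omega>] by (simp add: \<theta>_def)
      moreover have "fun_upd \<omega> (m + 1) x \<in> space (leb {1..m + 1})"
        using \<omega> by (auto simp: space_PiM PiE_def extensional_def)
      moreover have "fun_upd \<omega> (m + 1) x \<notin> cube (m + 1) (ival a y)"
      proof
        assume "fun_upd \<omega> (m + 1) x \<in> cube (m + 1) (ival a y)"
        then have "\<omega> i \<in> ival a y" if "i \<in> {1..m}" for i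
          using that PiE_mem[of "fun_upd \<omega> (m + 1) x" "{1..m + 1}" "\<lambda>_. ival a y" i] by auto
        moreover have "ival a y \<subseteq> ival a b"
          using xy(2) by (auto simp: mem_ival min_def max_def split: if_splits)
        ultimately have "\<omega> i \<in> ival a b" if "i \<in> {1..m}" for i using that by blast
        then show False using False \<omega> by (simp add: space_PiM PiE_iff)
      qed
      ultimately show ?thesis
        using \<Lambda>_density(3)[OF ab(1) y(1,2)] by (simp add: \<theta>_def)
    qed
  qed
  have "last_two m a b x y / M =
      (\<integral>\<^sup>+\<omega>. ennreal (\<Lambda> (m + 1) a y (fun_upd \<omega> (m + 1) x)) \<partial>leb {1..m})"
    unfolding last_two_def nn_integral_divide[OF measurable_fun_upd2[OF ab], symmetric]
    by (rule nn_integral_cong) (rule *)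
  also have "\<dots> = marginal (m + 1) (m + 1) (\<Lambda> (m + 1) a y) x"
    by (rule marginal_last_Suc[symmetric])
  finally show ?thesis by (simp add: M_def)
qed

text \<open>
  The joint density of the last two sites meets the hypotheses of \<open>bivariate_marginals_positive\<close>:
  given either site, the conditional density of the other one is positive below or above it.
\<close>

lemma marginals_positive_step:
  assumes last_pos: "\<And>b x. a < x \<Longrightarrow> x < b \<Longrightarrow> marginal (m + 1) (m + 1) (\<Lambda> (m + 1) a b) x \<noteq> 0"
    and "0 < a" "a < y" "y < b"
  shows "marginal (m + 2) (m + 2) (\<Lambda> (m + 2) a b) y \<noteq> 0"
    and "marginal (m + 2) (m + 1) (\<Lambda> (m + 2) a b) y \<noteq> 0"
proof -
  have ab: "0 < a" "0 < b" "a \<noteq> b" and "a < b" using assms(2-4) by auto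
  have last_but_one_pos: "last_two m a b x y \<noteq> 0"
    if "a < x" "x < y" "y < b" "marginal (m + 2) (m + 1) (\<Lambda> (m + 2) a b) x \<noteq> 0" for x y
  proof
    assume "last_two m a b x y = 0"
    then have "ennreal (L x b y) = 0"
      using last_two_given_last_but_one[OF ab, of x y m] that by (simp add: ival_less)
    moreover have "0 < L x b y" using that ab by (intro L_pos) (auto simp: mem_ival)
    ultimately show False by simp
  qed
  have last_pos': "last_two m a b x y \<noteq> 0"
    if "a < x" "x < y" "y < b" "marginal (m + 2) (m + 2) (\<Lambda> (m + 2) a b) y \<noteq> 0" for x y
  proof
    assume "last_two m a b x y = 0"
    then have "marginal (m + 1) (m + 1) (\<Lambda> (m + 1) a y) x = 0"
      using last_two_given_last[OF ab, of x y m] that by (simp add: ival_less)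
    with last_pos[OF that(1,2)] show False by simp
  qed
  have outside: "marginal (m + 2) (m + 2) (\<Lambda> (m + 2) a b) y = 0" if "y \<le> a \<or> b \<le> y" for y
    using that \<open>a < b\<close> by (intro marginal_eq_0[OF ab]) (auto simp: mem_ival)
  have total: "(\<integral>\<^sup>+y. marginal (m + 2) (m + 2) (\<Lambda> (m + 2) a b) y \<partial>lborel) \<noteq> 0"
    using nn_integral_marginal[OF ab, of "m + 2" "m + 2"] by simp
  note pos = bivariate_marginals_positive[OF measurable_last_two[OF ab, of m]
      marginal_last_but_one[OF ab] marginal_last[OF ab] last_but_one_pos last_pos' outside total assms(3,4)]
  show "marginal (m + 2) (m + 2) (\<Lambda> (m + 2) a b) y \<noteq> 0" by (rule pos(1))
  show "marginal (m + 2) (m + 1) (\<Lambda> (m + 2) a b) y \<noteq> 0" by (rule pos(2))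
qed

text \<open>
  By induction on the number of sites. The positivity for \<open>m + 1\<close> sites is needed between \<open>a\<close> and
  every \<open>y\<close>: it is what makes the conditional density of the last two of \<open>m + 2\<close> sites nonzero.
\<close>

lemma last_marginal_positive:
  assumes "0 < a" "a < y" "y < b"
  shows "marginal (m + 1) (m + 1) (\<Lambda> (m + 1) a b) y \<noteq> 0"
  using assms
proof (induction m arbitrary: y b)
  case 0
  have "0 < L a b y" using 0 by (intro L_pos) (auto simp: mem_ival)
  then show ?case using marginal_1[of a b y] 0 by simp
next
  case (Suc m)
  show ?case
    using marginals_positive_step(1)[of a m y b] Suc by simp
qed

text \<open>
  The index \<open>m\<close> counts the sites that precede the one in question.
\<close>

definition last_density :: "nat \<Rightarrow> real \<Rightarrow> real \<Rightarrow> real \<Rightarrow> real" where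
  "last_density m a b y = enn2real (marginal (m + 1) (m + 1) (\<Lambda> (m + 1) a b) y)"

definition last_but_one_density :: "nat \<Rightarrow> real \<Rightarrow> real \<Rightarrow> real \<Rightarrow> real" where
  "last_but_one_density m a b x = enn2real (marginal (m + 2) (m + 1) (\<Lambda> (m + 2) a b) x)"

lemma last_density_0: "0 < a \<Longrightarrow> 0 < b \<Longrightarrow> a \<noteq> b \<Longrightarrow> last_density 0 a b y = L a b y"
  using marginal_1[of a b y] L_density(2)[of a b y] by (simp add: last_density_def)

lemma last_density:
  assumes "0 < a" "a < y" "y < b"
  shows "marginal (m + 1) (m + 1) (\<Lambda> (m + 1) a b) y = ennreal (last_density m a b y)"
    and "0 < last_density m a b y"
proof -
  have ab: "0 < a" "0 < b" "a \<noteq> b" "a < b" using assms by auto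
  have "marginal (m + 1) (m + 1) (\<Lambda> (m + 1) a b) y \<noteq> top"
  proof (cases m)
    case 0
    then show ?thesis using marginal_1[OF ab(1-3)] by simp
  next
    case (Suc k)
    obtain x where x: "a < x" "x < y" using dense assms(2) by blast
    have nz: "marginal (k + 2) (k + 2) (\<Lambda> (k + 2) a b) y \<noteq> 0"
      using last_marginal_positive[OF assms, of "Suc k"] by simp
    have "marginal (k + 2) (k + 2) (\<Lambda> (k + 2) a b) y \<noteq> top"
      using ennreal_divide_eqD(1)[OF last_two_given_last[OF ab(1-3) _ _ nz, of x] nz]
        last_marginal_positive[OF ab(1) x] x assms by (simp add: ival_less)
    then show ?thesis using Suc by simp
  qed
  then show *: "marginal (m + 1) (m + 1) (\<Lambda> (m + 1) a b) y = ennreal (last_density m a b y)"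
    by (simp add: last_density_def less_top)
  show "0 < last_density m a b y"
    using last_marginal_positive[OF assms, of m] unfolding * by (simp add: ennreal_eq_0_iff not_le)
qed

text \<open>
  The joint density of the last two sites, computed by conditioning on either of them. All later
  arguments use the Markov property through these identities only.
\<close>

lemma last_two_sites:
  assumes "0 < a" "a < x" "x < y" "y < b"
  shows "last_two m a b x y = ennreal (last_but_one_density m a b x * L x b y)"
    and "last_two m a b x y = ennreal (last_density (Suc m) a b y * last_density m a y x)"
    and "last_but_one_density m a b x * L x b y = last_density (Suc m) a b y * last_density m a y x"
    and "0 < last_but_one_density m a b x"
proof -
  have ab: "0 < a" "0 < b" "a \<noteq> b" and mem: "x \<in> ival a b" "y \<in> ival a b"
    using assms by (auto simp: mem_ival)
  have L: "0 < L x b y" using assms by (intro L_pos) (auto simp: mem_ival)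
  have "marginal (m + 2) (m + 1) (\<Lambda> (m + 2) a b) x \<noteq> 0"
    using assms by (intro marginals_positive_step(2) last_marginal_positive) auto
  note nz = ennreal_divide_eqD[OF last_two_given_last_but_one[OF ab mem this] this]
  have S: "marginal (m + 2) (m + 1) (\<Lambda> (m + 2) a b) x = ennreal (last_but_one_density m a b x)"
    using nz(1) L by (simp add: last_but_one_density_def less_top)
  then show S_pos: "0 < last_but_one_density m a b x"
    using \<open>marginal (m + 2) (m + 1) (\<Lambda> (m + 2) a b) x \<noteq> 0\<close> by (simp add: ennreal_eq_0_iff not_le)
  show 1: "last_two m a b x y = ennreal (last_but_one_density m a b x * L x b y)"
    using nz(2) L S_pos unfolding S by (simp add: ennreal_mult)
  have "a < y" using assms by simp
  note R = last_density[OF assms(1) \<open>a < y\<close> assms(4), of "Suc m"]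
    and R' = last_density[OF assms(1-3), of m]
  have R2: "marginal (m + 2) (m + 2) (\<Lambda> (m + 2) a b) y = ennreal (last_density (Suc m) a b y)"
    using R(1) by simp
  then have "marginal (m + 2) (m + 2) (\<Lambda> (m + 2) a b) y \<noteq> 0" using R(2) by simp
  from ennreal_divide_eqD(2)[OF last_two_given_last[OF ab mem this] this]
  show 2: "last_two m a b x y = ennreal (last_density (Suc m) a b y * last_density m a y x)"
    unfolding R'(1) R2 using R(2) R'(2) by (simp add: ennreal_mult)
  show "last_but_one_density m a b x * L x b y = last_density (Suc m) a b y * last_density m a y x"
    using 1 2 S_pos L R(2) R'(2) by (simp add: ennreal_inj)
qed

lemma nn_integral_last_density:
  assumes "0 < a" "a < b"
  shows "(\<integral>\<^sup>+y\<in>ival a b. ennreal (last_density m a b y) \<partial>lborel) = 1"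
proof -
  have ab: "0 < a" "0 < b" "a \<noteq> b" using assms by auto
  have "(\<integral>\<^sup>+y\<in>ival a b. ennreal (last_density m a b y) \<partial>lborel) =
      (\<integral>\<^sup>+y. marginal (m + 1) (m + 1) (\<Lambda> (m + 1) a b) y \<partial>lborel)"
  proof (intro nn_integral_cong)
    fix y
    show "ennreal (last_density m a b y) * indicator (ival a b) y =
        marginal (m + 1) (m + 1) (\<Lambda> (m + 1) a b) y"
    proof (cases "y \<in> ival a b")
      case True
      then show ?thesis using last_density(1)[OF assms(1), of y b m] assms(2) by (simp add: ival_less)
    next
      case False
      then show ?thesis using marginal_eq_0[OF ab, of "m + 1" "m + 1" y] by simp
    qed
  qed
  then show ?thesis using nn_integral_marginal[OF ab, of "m + 1" "m + 1"] by simp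
qed

section \<open>Finiteness of the chain masses\<close>

text \<open>
  Any positive factor in front of the product form is the normalization, because the one-site
  density has integral 1.
\<close>

lemma normalization_unique:
  assumes g: "case_prod g \<in> borel_measurable borel" "\<And>u v. 0 < g u v" "\<And>u v. g u v = g v u"
    and ab: "0 < a" "0 < b" "a \<noteq> b"
    and F: "0 < F" "\<And>x. x \<in> ival a b \<Longrightarrow> L a b x = F * (g a x * g x b)"
  shows "normalization g a b = F"
    and "L a b x = normalization g a b * g b x * g x a * indicator (ival a b) x"
proof -
  have "1 = (\<integral>\<^sup>+x. ennreal (L a b x) \<partial>lborel)" using L_density(4)[OF ab] by simp
  also have "\<dots> = (\<integral>\<^sup>+x. ennreal F * (ennreal (g a x) * ennreal (g x b) * indicator (ival a b) x) \<partial>lborel)"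
  proof (intro nn_integral_cong)
    fix x
    show "ennreal (L a b x) = ennreal F * (ennreal (g a x) * ennreal (g x b) * indicator (ival a b) x)"
      using F(1) F(2)[of x] g(2)[of a x] g(2)[of x b] L_density(3)[OF ab, of x]
      by (auto simp: indicator_def ennreal_mult less_imp_le)
  qed
  also have "\<dots> = ennreal F * chain_mass g 1 a b"
  proof -
    have "(\<lambda>x. ennreal (g a x) * ennreal (g x b) * indicator (ival a b) x) \<in> borel_measurable lborel"
      by (intro borel_measurable_times_ennreal measurable_compose[OF _ measurable_ennreal]
          measurable_weight[OF g(1)] borel_measurable_indicator) auto
    then show ?thesis by (simp add: nn_integral_cmult)
  qed
  finally have "F * enn2real (chain_mass g 1 a b) = 1"
    using F(1) by (metis enn2real_mult enn2real_ennreal enn2real_1 less_imp_le)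
  then show N: "normalization g a b = F"
    unfolding normalization_eq[OF g] by (intro inverse_unique) (metis mult.commute)
  show "L a b x = normalization g a b * g b x * g x a * indicator (ival a b) x"
    unfolding N using F(2)[of x] L_density(3)[OF ab, of x] g(3)[of a x] g(3)[of x b]
    by (auto simp: indicator_def)
qed

text \<open>
  Write \<open>C\<^sub>n\<close> for the chain mass with \<open>n\<close> sites. By induction, the density of the last of \<open>n + 1\<close>
  sites between \<open>a\<close> and \<open>b\<close> is \<open>K C\<^sub>n(a,y) g(y,b)\<close> with a constant \<open>K > 0\<close>; integrating over \<open>y\<close> gives
  \<open>1 = K C\<^sub>n\<^sub>+\<^sub>1(a,b)\<close>. In the induction step, the product form and the induction hypothesis between \<open>a\<close>
  and \<open>y\<close> turn the identity for the last two sites into one whose left side depends on \<open>y\<close> and whose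
  right side depends on \<open>x\<close>, for all \<open>x < y\<close>. So both sides are constant.
\<close>

lemma chain_mass_finite:
  assumes g: "case_prod g \<in> borel_measurable borel" "\<And>u v. 0 < g u v" "\<And>u v. g u v = g v u"
    and "0 \<le> c"
    and F: "\<And>a b x. c < a \<Longrightarrow> a < x \<Longrightarrow> x < b \<Longrightarrow> b < d \<Longrightarrow> L a b x = F a b * (g a x * g x b)"
    and ab: "c < a" "a < b" "b < d"
  shows "chain_mass g n a b < \<infinity>"
proof -
  let ?C = "\<lambda>n a b. enn2real (chain_mass g n a b)"
  have C_pos: "0 < ?C n a b" if "chain_mass g n a b < \<infinity>" "a < b" for n a b
    using that chain_mass_pos[OF g(1,2), of a b n] by (simp add: enn2real_positive_iff)
  \<comment> \<open>\<open>K\<close> times the integrand that defines \<open>chain_mass g (Suc n) a b\<close> is a probability density.\<close>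
  have total: "chain_mass g (Suc n) a b = ennreal (1 / K)"
    if "c < a" "a < b" "0 < K" "\<And>y. a < y \<Longrightarrow> y < b \<Longrightarrow> chain_mass g n a y < \<infinity>"
      "\<And>y. a < y \<Longrightarrow> y < b \<Longrightarrow> last_density n a b y = K * (?C n a y * g y b)" for n a b K
  proof -
    have "1 = (\<integral>\<^sup>+y\<in>ival a b. ennreal (last_density n a b y) \<partial>lborel)"
      using nn_integral_last_density[of a b n] that \<open>0 \<le> c\<close> by simp
    also have "\<dots> = (\<integral>\<^sup>+y. ennreal K * (chain_mass g n a y * ennreal (g y b) * indicator (ival a b) y) \<partial>lborel)"
    proof (intro nn_integral_cong)
      fix y
      show "ennreal (last_density n a b y) * indicator (ival a b) y =
          ennreal K * (chain_mass g n a y * ennreal (g y b) * indicator (ival a b) y)"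
      proof (cases "y \<in> ival a b")
        case True
        then have y: "a < y" "y < b" using that(2) by (auto simp: ival_less)
        have "chain_mass g n a y = ennreal (?C n a y)" using that(4)[OF y] by simp
        then show ?thesis
          unfolding that(5)[OF y]
          using that(3) g(2)[of y b] C_pos[OF that(4)[OF y] y(1)] True
          by (simp add: ennreal_mult less_imp_le)
      qed simp
    qed
    also have "\<dots> = ennreal K * chain_mass g (Suc n) a b"
    proof -
      have "(\<lambda>y. chain_mass g n a y * ennreal (g y b) * indicator (ival a b) y) \<in> borel_measurable lborel"
        by (intro borel_measurable_times_ennreal measurable_compose[OF _ measurable_ennreal]
            measurable_weight[OF g(1)] measurable_chain_mass[OF g(1)] borel_measurable_indicator) auto
      then show ?thesis by (simp add: nn_integral_cmult)
    qed
    finally have "ennreal K * chain_mass g (Suc n) a b = 1" by simp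
    then have "ennreal (1 / K) * (ennreal K * chain_mass g (Suc n) a b) = ennreal (1 / K)" by simp
    then show ?thesis
      using that(3) by (simp add: mult.assoc[symmetric] ennreal_mult[symmetric])
  qed
  have "chain_mass g n a b < \<infinity> \<and> (\<exists>K>0. \<forall>y. a < y \<and> y < b \<longrightarrow>
      last_density n a b y = K * (?C n a y * g y b))" if "c < a" "a < b" "b < d" for n a b
    using that
  proof (induction n arbitrary: b)
    case 0
    have "0 < a" using 0 \<open>0 \<le> c\<close> by simp
    obtain x where x: "a < x" "x < b" using dense 0(2) by blast
    have "0 < L a b x" using x \<open>0 < a\<close> by (intro L_pos) (auto simp: mem_ival)
    then have "0 < F a b"
      unfolding F[OF 0(1) x 0(3)]
      by (rule zero_less_mult_pos2) (use g(2)[of a x] g(2)[of x b] in simp)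
    moreover have "last_density 0 a b y = F a b * (?C 0 a y * g y b)" if "a < y \<and> y < b" for y
      using last_density_0[of a b y] F[OF 0(1), of y b] that 0 \<open>0 < a\<close> g(2)[of a y] by simp
    ultimately show ?case by auto
  next
    case (Suc n)
    have "0 < a" using Suc.prems \<open>0 \<le> c\<close> by simp
    from Suc.IH[OF Suc.prems] obtain K where K: "0 < K"
      "\<And>y. a < y \<Longrightarrow> y < b \<Longrightarrow> last_density n a b y = K * (?C n a y * g y b)" by blast
    have fin: "chain_mass g n a y < \<infinity>" if "a < y" "y < b" for y
      using Suc.IH[of y] that Suc.prems by simp
    have fin': "chain_mass g (Suc n) a y < \<infinity>" if "a < y" "y < d" for y
    proof -
      from Suc.IH[OF Suc.prems(1) that] obtain K where "0 < K"
        "\<And>z. a < z \<Longrightarrow> z < y \<Longrightarrow> last_density n a y z = K * (?C n a z * g z y)" by blast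
      moreover have "chain_mass g n a z < \<infinity>" if "a < z" "z < y" for z
        using Suc.IH[of z] that \<open>y < d\<close> Suc.prems by simp
      ultimately have "chain_mass g (Suc n) a y = ennreal (1 / K)"
        using total[of a y K n] that Suc.prems by blast
      then show ?thesis by simp
    qed
    \<comment> \<open>Separation of variables: the left side is a function of \<open>y\<close>, the right side one of \<open>x\<close>.\<close>
    have sep: "last_density (Suc n) a b y / (?C (Suc n) a y * g y b) =
        last_but_one_density n a b x * F x b / ?C n a x" if "a < x" "x < y" "y < b" for x y
    proof -
      from Suc.IH[of y] that Suc.prems obtain K where K: "0 < K"
        "\<And>z. a < z \<Longrightarrow> z < y \<Longrightarrow> last_density n a y z = K * (?C n a z * g z y)" by auto
      have "chain_mass g (Suc n) a y = ennreal (1 / K)"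
        using total[of a y K n] K that Suc.prems fin by auto
      then have "K = 1 / ?C (Suc n) a y" using K(1) by simp
      then have R: "last_density n a y x = ?C n a x * g x y / ?C (Suc n) a y"
        using K(2)[of x] that by simp
      have pos: "0 < ?C n a x" "0 < ?C (Suc n) a y"
        by (rule C_pos; use fin[of x] fin'[of y] that Suc.prems in simp)+
      have "last_but_one_density n a b x * (F x b * (g x y * g y b)) =
          last_density (Suc n) a b y * (?C n a x * g x y / ?C (Suc n) a y)"
        using last_two_sites(3)[OF \<open>0 < a\<close> that, of n] F[of x y b] that Suc.prems R by simp
      then show ?thesis
        using pos g(2)[of x y] g(2)[of y b] by (simp add: field_simps)
    qed
    define m where "m = (a + b) / 2"
    have m: "a < m" "m < b" using Suc.prems by (auto simp: m_def)
    define K' where "K' = last_density (Suc n) a b m / (?C (Suc n) a m * g m b)"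
    have "0 < K'"
      using last_density(2)[OF \<open>0 < a\<close> m, of "Suc n"] C_pos[OF fin'[of m]] g(2)[of m b] m Suc.prems
      by (simp add: K'_def)
    moreover have "last_density (Suc n) a b y = K' * (?C (Suc n) a y * g y b)" if y: "a < y" "y < b" for y
    proof -
      \<comment> \<open>The values at \<open>y\<close> and at the reference point \<open>m\<close> agree with the value at an \<open>x\<close> below both.\<close>
      obtain x where x: "a < x" "x < min y m" using dense[of a "min y m"] y m by auto
      then have "last_density (Suc n) a b y / (?C (Suc n) a y * g y b) = K'"
        using sep[of x y] sep[of x m] that m by (simp add: K'_def)
      then show ?thesis
        using C_pos[OF fin'[of y]] g(2)[of y b] that Suc.prems by (simp add: field_simps)
    qed
    ultimately show ?case using fin'[of b] Suc.prems by blast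
  qed
  then show ?thesis using ab by blast
qed

section \<open>The product form of the one-site density\<close>

definition pair_density :: "real \<Rightarrow> real \<Rightarrow> real \<Rightarrow> real \<Rightarrow> real" where
  "pair_density c d x y = enn2real (last_two 0 c d x y)"

text \<open>
  The density at \<open>x\<close> of the middle one of three sites between \<open>c\<close> and \<open>d\<close>, divided by the product of the densities
  at \<open>x\<close> of the first and of the second one of two sites.
\<close>

definition middle_ratio :: "real \<Rightarrow> real \<Rightarrow> real \<Rightarrow> real" where
  "middle_ratio c d x =
     last_but_one_density 1 c d x / (last_but_one_density 0 c d x * last_density 1 c d x)"

text \<open>
  The two-site density between \<open>c\<close> and \<open>d\<close>, made symmetric. As \<open>g(a,x) g(x,b)\<close> contains two of
  these, a correction that depends on \<open>x\<close> is distributed evenly over both; this explains the square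
  root. The value 1 off the domain only serves positivity.
\<close>

definition kernel :: "real \<Rightarrow> real \<Rightarrow> real \<Rightarrow> real \<Rightarrow> real" where
  "kernel c d u v =
     (if c < min u v \<and> u \<noteq> v \<and> max u v < d
      then pair_density c d (min u v) (max u v) * sqrt (middle_ratio c d u * middle_ratio c d v)
      else 1)"

lemma kernel_commute: "kernel c d u v = kernel c d v u"
  unfolding kernel_def min.commute[of v u] max.commute[of v u]
    mult.commute[of "middle_ratio c d v" "middle_ratio c d u"] by auto

lemma pair_density:
  assumes "0 < c" "c < x" "x < y" "y < d"
  shows "pair_density c d x y = last_but_one_density 0 c d x * L x d y"
    and "pair_density c d x y = last_density 1 c d y * L c y x"
    and "0 < pair_density c d x y"
proof -
  note l = last_two_sites[OF assms, of 0]
  have L: "0 < L x d y" using assms by (intro L_pos) (auto simp: mem_ival)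
  show 1: "pair_density c d x y = last_but_one_density 0 c d x * L x d y"
    using l(1,4) L by (simp add: pair_density_def)
  show "pair_density c d x y = last_density 1 c d y * L c y x"
    unfolding 1 using l(3) last_density_0[of c y x] assms by simp
  show "0 < pair_density c d x y"
    unfolding 1 using l(4) L by simp
qed

lemma middle_ratio_pos:
  assumes "0 < c" "c < x" "x < d"
  shows "0 < middle_ratio c d x"
proof -
  obtain y where y: "x < y" "y < d" using dense assms(3) by blast
  show ?thesis
    using last_two_sites(4)[OF assms(1,2) y] last_density(2)[OF assms, of 1]
    by (simp add: middle_ratio_def)
qed

lemma kernel_pos:
  assumes "0 < c"
  shows "0 < kernel c d u v"
  using assms by (auto simp: kernel_def min_def max_def intro!: mult_pos_pos pair_density(3) middle_ratio_pos)

lemma measurable_kernel: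
  assumes "0 < c" "c < d"
  shows "case_prod (kernel c d) \<in> borel_measurable borel"
proof -
  have cd: "0 < c" "0 < d" "c \<noteq> d" using assms by auto
  have lb1: "last_but_one_density m c d \<in> borel_measurable borel" for m
  proof -
    have "(\<lambda>x. \<integral>\<^sup>+y. last_two m c d x y \<partial>lborel) \<in> borel_measurable borel"
      using measurable_last_two[OF cd, of m] by (intro lborel.borel_measurable_nn_integral) simp
    then show ?thesis
      unfolding last_but_one_density_def[abs_def] marginal_last_but_one[OF cd] by measurable
  qed
  have l1: "last_density 1 c d \<in> borel_measurable borel"
  proof -
    have "(\<lambda>y. \<integral>\<^sup>+x. last_two 0 c d x y \<partial>lborel) \<in> borel_measurable borel"
      using measurable_compose[OF measurable_Pair measurable_last_two[OF cd, of 0], of snd "borel \<Otimes>\<^sub>M borel" fst]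
      by (intro lborel.borel_measurable_nn_integral) (simp add: split_beta')
    then have "(\<lambda>y. enn2real (\<integral>\<^sup>+x. last_two 0 c d x y \<partial>lborel)) \<in> borel_measurable borel"
      by (rule borel_measurable_enn2real)
    moreover have eq: "last_density 1 c d y = enn2real (\<integral>\<^sup>+x. last_two 0 c d x y \<partial>lborel)" for y
      using marginal_last[OF cd, of 0 y] by (simp add: last_density_def)
    have "last_density 1 c d = (\<lambda>y. enn2real (\<integral>\<^sup>+x. last_two 0 c d x y \<partial>lborel))" by (rule ext) (rule eq)
    ultimately show ?thesis by (simp only:)
  qed
  have ratio: "middle_ratio c d \<in> borel_measurable borel"
    unfolding middle_ratio_def[abs_def] using lb1 l1 by (intro borel_measurable_divide borel_measurable_times)
  have pair: "(\<lambda>z. pair_density c d (fst z) (snd z)) \<in> borel_measurable (borel \<Otimes>\<^sub>M borel)"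
    unfolding pair_density_def using measurable_last_two[OF cd, of 0]
    by (intro borel_measurable_enn2real) (simp add: split_beta')
  have mm: "(\<lambda>z::real \<times> real. min (fst z) (snd z)) \<in> borel_measurable (borel \<Otimes>\<^sub>M borel)"
    "(\<lambda>z::real \<times> real. max (fst z) (snd z)) \<in> borel_measurable (borel \<Otimes>\<^sub>M borel)"
    by measurable
  have "(\<lambda>z. pair_density c d (min (fst z) (snd z)) (max (fst z) (snd z))) \<in> borel_measurable (borel \<Otimes>\<^sub>M borel)"
    using measurable_compose[OF measurable_Pair[OF mm] pair] by simp
  moreover have "(\<lambda>z. sqrt (middle_ratio c d (fst z) * middle_ratio c d (snd z))) \<in>
      borel_measurable (borel \<Otimes>\<^sub>M borel)"
    using measurable_compose[OF measurable_fst ratio] measurable_compose[OF measurable_snd ratio]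
    by measurable
  moreover have "{z::real \<times> real. c < min (fst z) (snd z) \<and> fst z \<noteq> snd z \<and> max (fst z) (snd z) < d}
      \<in> sets (borel \<Otimes>\<^sub>M borel)"
    unfolding borel_prod
    by (intro borel_open open_Collect_conj open_Collect_less open_Collect_neq continuous_intros)
  ultimately have "(\<lambda>z. kernel c d (fst z) (snd z)) \<in> borel_measurable (borel \<Otimes>\<^sub>M borel)"
    unfolding kernel_def by (intro measurable_If borel_measurable_times) (auto simp: space_pair_measure)
  then show ?thesis by (simp add: borel_prod split_beta')
qed

text \<open>
  Three instances of \<open>last_two_sites\<close> are combined. Two sites between \<open>c\<close> and \<open>b\<close> relate
  \<open>L a b x\<close> to \<open>L c x a\<close> through the density at \<open>x\<close> of the second of them; three sites between \<open>c\<close>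
  and \<open>d\<close> relate that density to \<open>L x d b\<close>; and two sites between \<open>c\<close> and \<open>d\<close> express \<open>L c x a\<close> and
  \<open>L x d b\<close> by the pair density. What remains are factors of \<open>x\<close> alone, which make up
  \<open>middle_ratio\<close>, and factors of \<open>a\<close> and \<open>b\<close>, which go into \<open>F\<close>.
\<close>

lemma kernel_factorizes:
  assumes c: "0 < c" and ab: "c < a" "a < b" "b < d"
  obtains F where "0 < F" "\<And>x. a < x \<Longrightarrow> x < b \<Longrightarrow> L a b x = F * (kernel c d a x * kernel c d x b)"
proof
  let ?\<phi> = "middle_ratio c d"
  define N where "N = last_density 2 c d b * last_but_one_density 0 c b a * sqrt (?\<phi> a * ?\<phi> b)"
  have \<phi>: "0 < ?\<phi> a" "0 < ?\<phi> b" using c ab by (auto intro!: middle_ratio_pos)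
  obtain t where t: "a < t" "t < b" using dense ab(2) by blast
  have pos: "0 < last_density 2 c d b" "0 < last_but_one_density 0 c b a"
    using last_density(2)[of c b d 2] last_two_sites(4)[of c a t b 0] t c ab by auto
  then show "0 < 1 / N" using \<phi> by (simp add: N_def)
  fix x assume x: "a < x" "x < b"
  have ax: "pair_density c d a x = last_density 1 c d x * L c x a"
    and xb: "pair_density c d x b = last_but_one_density 0 c d x * L x d b"
    using pair_density(2)[of c a x d] pair_density(1)[of c x b d] x c ab by simp_all
  have pos_x: "0 < ?\<phi> x" "0 < last_but_one_density 0 c d x" "0 < last_density 1 c d x"
    using last_two_sites(4)[of c x b d 0] last_density(2)[of c x d 1] middle_ratio_pos[of c x d] x c ab by auto
  have 1: "last_but_one_density 0 c b a * L a b x = last_density 1 c b x * L c x a"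
    using last_two_sites(3)[of c a x b 0] last_density_0[of c x a] x c ab by simp
  have 2: "last_but_one_density 1 c d x * L x d b = last_density 2 c d b * last_density 1 c b x"
    using last_two_sites(3)[of c x b d 1] x c ab by (simp add: numeral_2_eq_2)
  have "last_density 2 c d b * last_but_one_density 0 c b a * L a b x =
      last_density 2 c d b * last_density 1 c b x * L c x a"
    using 1 by simp
  also have "\<dots> = last_but_one_density 1 c d x * L x d b * L c x a"
    using 2 by simp
  also have "\<dots> = ?\<phi> x * (pair_density c d a x * pair_density c d x b)"
    unfolding ax xb middle_ratio_def using pos_x(2,3) by simp
  finally have main: "last_density 2 c d b * last_but_one_density 0 c b a * L a b x =
      ?\<phi> x * (pair_density c d a x * pair_density c d x b)" .
  have sqrt: "sqrt (?\<phi> a * ?\<phi> x) * sqrt (?\<phi> x * ?\<phi> b) = ?\<phi> x * sqrt (?\<phi> a * ?\<phi> b)"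
  proof -
    have "sqrt (?\<phi> a * ?\<phi> x) * sqrt (?\<phi> x * ?\<phi> b) =
        sqrt (?\<phi> x) * sqrt (?\<phi> x) * (sqrt (?\<phi> a) * sqrt (?\<phi> b))"
      unfolding real_sqrt_mult by (simp only: mult_ac)
    then show ?thesis using pos_x(1) by (simp add: real_sqrt_mult)
  qed
  have "kernel c d a x * kernel c d x b =
      pair_density c d a x * pair_density c d x b * (?\<phi> x * sqrt (?\<phi> a * ?\<phi> b))"
    proof -
      have "kernel c d a x = pair_density c d a x * sqrt (?\<phi> a * ?\<phi> x)"
        "kernel c d x b = pair_density c d x b * sqrt (?\<phi> x * ?\<phi> b)"
        using x ab by (simp_all add: kernel_def)
      then show ?thesis unfolding sqrt[symmetric] by (simp only: mult_ac)
    qed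
  also have "\<dots> = ?\<phi> x * (pair_density c d a x * pair_density c d x b) * sqrt (?\<phi> a * ?\<phi> b)"
    by (simp only: mult_ac)
  also have "\<dots> = N * L a b x"
    unfolding main[symmetric] N_def by (simp only: mult_ac)
  finally show "L a b x = 1 / N * (kernel c d a x * kernel c d x b)"
    using \<open>0 < 1 / N\<close> by (simp add: field_simps)
qed

text \<open>
  For \<open>a < b\<close> the product form and the finiteness are already known. The case \<open>a > b\<close> follows
  because the one-site density, the kernel and the chain mass are all symmetric.
\<close>

theorem factorization_on_kernel:
  assumes "0 < c" "c < d"
  shows "factorization_on L {c<..<d} (kernel c d)"
proof -
  note g = measurable_kernel[OF assms] kernel_pos[OF assms(1)] kernel_commute
  have up: "L a b x = normalization (kernel c d) a b * kernel c d b x * kernel c d x a * indicator (ival a b) x"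
    "x \<in> ival a b \<Longrightarrow> L a b x = normalization (kernel c d) a b * (kernel c d a x * kernel c d x b)"
    "L b a x = normalization (kernel c d) b a * kernel c d a x * kernel c d x b * indicator (ival b a) x"
    if ab: "c < a" "a < b" "b < d" for a b x
  proof -
    obtain F where F: "0 < F"
      "\<And>x. a < x \<Longrightarrow> x < b \<Longrightarrow> L a b x = F * (kernel c d a x * kernel c d x b)"
      using kernel_factorizes[OF assms(1) ab] by blast
    have F': "L a b x = F * (kernel c d a x * kernel c d x b)" if "x \<in> ival a b" for x
      using F(2) that ab by (simp add: mem_ival)
    have pos: "0 < a" "0 < b" "a \<noteq> b" "b \<noteq> a" using ab assms by auto
    show "L a b x = normalization (kernel c d) a b * kernel c d b x * kernel c d x a * indicator (ival a b) x"
      by (rule normalization_unique(2)[OF g pos(1-3) F(1) F'])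
    have "normalization (kernel c d) a b = F"
      by (rule normalization_unique(1)[OF g pos(1-3) F(1) F'])
    then show "L a b x = normalization (kernel c d) a b * (kernel c d a x * kernel c d x b)" if "x \<in> ival a b"
      using F'[OF that] by simp
    have "L b a x = F * (kernel c d b x * kernel c d x a)" if "x \<in> ival b a" for x
      using F'[of x] that
      unfolding L_commute[OF pos(2,1,4)] ival_commute[of b a] kernel_commute[of c d b x] kernel_commute[of c d x a]
      by (simp add: mult.commute)
    from normalization_unique(2)[OF g pos(2,1,4) F(1) this]
    show "L b a x = normalization (kernel c d) b a * kernel c d a x * kernel c d x b * indicator (ival b a) x" .
  qed
  have finite: "chain_mass (kernel c d) n a b < \<infinity>" if "c < a" "a < b" "b < d" for n a b
  proof (rule chain_mass_finite[OF g, where c = c and d = d and F = "normalization (kernel c d)"])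
    show "L a b x = normalization (kernel c d) a b * (kernel c d a x * kernel c d x b)"
      if "c < a" "a < x" "x < b" "b < d" for a b x
      by (rule up(2)) (use that in \<open>auto simp: mem_ival\<close>)
  qed (use assms(1) that in auto)
  have eq: "L a b x = normalization (kernel c d) a b * kernel c d b x * kernel c d x a * indicator (ival a b) x"
    if "a \<in> {c<..<d}" "b \<in> {c<..<d}" "a \<noteq> b" for a b x
  proof (cases "a < b")
    case True
    then show ?thesis using that by (intro up(1)) auto
  next
    case False
    then show ?thesis using that by (intro up(3)) auto
  qed
  have fin: "chain_mass (kernel c d) n a b < \<infinity>"
    if "a \<in> {c<..<d}" "b \<in> {c<..<d}" "a \<noteq> b" for a b n
  proof (cases "a < b")
    case True
    then show ?thesis using that by (intro finite) auto
  next
    case False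
    then show ?thesis using that unfolding chain_mass_commute[OF g, of n a b] by (intro finite) auto
  qed
  show ?thesis
    unfolding factorization_on_def
  proof (intro conjI allI ballI impI)
    show "case_prod (kernel c d) \<in> borel_measurable borel" by (rule g(1))
    show "0 < kernel c d u v" "kernel c d u v = kernel c d v u" for u v by (rule g(2), rule g(3))
  qed ((rule eq; assumption) | (rule fin; assumption))+
qed

end

section \<open>The equivalence\<close>

theorem theorem4p5:
  fixes L :: "real \<Rightarrow> real \<Rightarrow> real \<Rightarrow> real"
  assumes "one_site_density L"
  shows "(\<exists>\<Lambda>. density_family \<Lambda> \<and> symmetric_family \<Lambda> \<and> two_sided_markov \<Lambda> \<and>
              has_one_site_density \<Lambda> L)
     \<longleftrightarrow>
     (\<forall>z1>0. \<forall>z2>0. \<exists>g :: real \<Rightarrow> real \<Rightarrow> real.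
        (\<forall>u v. g u v > 0) \<and>
        (\<forall>u v. g u v = g v u) \<and>
        case_prod g \<in> borel_measurable borel \<and>
        (\<forall>a\<in>ival z1 z2. \<forall>b\<in>ival z1 z2. a \<noteq> b \<longrightarrow>
           (\<forall>x. L a b x = normalization g a b * g b x * g x a * indicator (ival a b) x)) \<and>
        (\<forall>a\<in>ival z1 z2. \<forall>b\<in>ival z1 z2. a \<noteq> b \<longrightarrow>
           (\<forall>n. chain_mass g n a b < \<infinity>)))"
proof -
  have "(\<exists>\<Lambda>. density_family \<Lambda> \<and> symmetric_family \<Lambda> \<and> two_sided_markov \<Lambda> \<and> has_one_site_density \<Lambda> L)
      \<longleftrightarrow> (\<forall>z1>0. \<forall>z2>0. \<exists>g. factorization_on L (ival z1 z2) g)" (is "?family \<longleftrightarrow> ?factorization")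
  proof
    assume ?family
    then obtain \<Lambda> where "markov_family \<Lambda> L"
      using assms unfolding markov_family_def by blast
    then interpret markov_family \<Lambda> L .
    show ?factorization
    proof (intro allI impI exI)
      fix z1 z2 :: real assume "0 < z1" "0 < z2"
      \<comment> \<open>Adding 1 makes the interval nondegenerate even if \<open>z1 = z2\<close>.\<close>
      then have "factorization_on L {min z1 z2<..<max z1 z2 + 1} (kernel (min z1 z2) (max z1 z2 + 1))"
        by (intro factorization_on_kernel) auto
      then show "factorization_on L (ival z1 z2) (kernel (min z1 z2) (max z1 z2 + 1))"
        by (rule factorization_on_subset) (auto simp: ival_def)
    qed
  next
    assume R: ?factorization
    have "\<exists>g. factorization_on L (segment a b) g" if "0 < a" "0 < b" for a b
    proof -
      have "0 < min a b / 2" "0 < max a b * 2" using that by auto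
      with R obtain g where "factorization_on L (ival (min a b / 2) (max a b * 2)) g" by blast
      moreover have "segment a b \<subseteq> ival (min a b / 2) (max a b * 2)"
        using that by (auto simp: mem_ival min_def max_def split: if_splits)
      ultimately show ?thesis using factorization_on_subset by blast
    qed
    then show ?family using chain_family_markov[of L] by blast
  qed
  then show ?thesis unfolding factorization_on_def .
qed

end
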